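(* Suppose that the problem $\min\{g(x)+f(w): Ax+Bw=b\}$ satisfies the standing assumption, and let $(\bar x,\bar w,\bar y)$ be a saddle point of $\mathbb{L}$. Let $\{(x_k,w_k,y_k)\}_{k\ge1}$ be generated by Algorithm 2 (described in the context, with the extended range $\psi\in(1,1+\sqrt3)$). Then $\{(x_k,w_k,y_k)\}_{k\ge1}$ converges to a saddle point of $\mathbb{L}$.
   Context: **Problem.** $g:\mathbb{R}^q\to\mathbb{R}\cup\{+\infty\}$ and $f:\mathbb{R}^p\to\mathbb{R}\cup\{+\infty\}$ are proper, closed, convex functions, $A\in\mathbb{R}^{m\times q}$, $B\in\mathbb{R}^{m\times p}$, $b\in\mathbb{R}^m$. The problem is $\min_{x\in\mathbb{R}^q,\,w\in\mathbb{R}^p} g(x)+f(w)$ subject to $Ax+Bw=b$. Set $\Phi(x,w):=g(x)+f(w)$, $\mathbb{L}(x,w,y):=\Phi(x,w)+\langle y,Ax+Bw-b\rangle$ and, for $\sigma>0$, $\mathbb{L}_\sigma(x,w,y):=\mathbb{L}(x,w,y)+\frac{\sigma}{2}\|Ax+Bw-b\|^2$. A triple $(x^\star,w^\star,y^\star)$ is a saddle point of $\mathbb{L}$ if $\mathbb{L}(x^\star,w^\star,y)\le\mathbb{L}(x^\star,w^\star,y^\star)\le\mathbb{L}(x,w,y^\star)$ for all $(x,w,y)\in\mathbb{R}^q\times\mathbb{R}^p\times\mathbb{R}^m$. **Standing assumption.** The solution set of the problem is nonempty, and there exist $\tilde x\in\operatorname{ri}(\operatorname{dom} g)$ and $\tilde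 w\in\operatorname{ri}(\operatorname{dom} f)$ with $A\tilde x+B\tilde w=b$ ($\operatorname{ri}$ = relative interior). **Notation.** $\|\cdot\|$ is the Euclidean norm. For a symmetric positive semidefinite $M$, $\|y\|_M:=\sqrt{y^\top My}$. $\lambda_{\min}(M)$ is the smallest eigenvalue of $M$. **Algorithm 2.** Let $S\in\mathbb{R}^{q\times q}$ and $T\in\mathbb{R}^{p\times p}$ be symmetric positive definite, $x_0\in\mathbb{R}^q$, $w_0\in\mathbb{R}^p$, $y_0\in\mathbb{R}^m$, $u_0=x_0$, $\tau_0>0$, $\beta>0$, $\psi\in(1,1+\sqrt3)$, $0<\mu<\frac{\psi(2+2\psi-\psi^2)}{2(\psi+1)}$. For $k=1,2,\dots$: $$u_k=\tfrac{\psi-1}{\psi}x_{k-1}+\tfrac1\psi u_{k-1},\qquad x_k=\arg\min_x\Big\{\mathbb{L}(x,w_{k-1},y_{k-1})+\tfrac{1}{2\tau_{k-1}}\|x-u_k\|_S^2\Big\},$$ $$\tau_k=\min\Big\{\tau_{k-1},\frac{\mu\sqrt{\lambda_{\min}(S)}}{\sqrt\beta\,L_k}\Big\},\qquad L_k:=\frac{\|Ax_k-Ax_{k-1}\|}{\|x_k-x_{k-1}\|},$$ with the convention that $\tau_k=\tau_{k-1}$ whenever $Ax_k=Ax_{k-1}$ (in particular whenever $x_k=x_{k-1}$), $$w_k=\arg\min_w\Big\{\mathbb{L}_{\beta\tau_k}(x_k,w,y_{k-1})+\tfrac12\|w-w_{k-1}\|_T^2\Big\},\qquad y_k=y_{k-1}+\beta\tau_k(Ax_k+Bw_k-b).$$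 *)

theory Defs
  imports "HOL-Analysis.Analysis"
begin

text \<open>Convex functions with values in \<open>\<real> \<union> {+\<infinity>}\<close> are \<open>ereal\<close>-valued; properness excludes \<open>-\<infinity>\<close>.\<close>

definition effective_dom :: "('a \<Rightarrow> ereal) \<Rightarrow> 'a set" where
  "effective_dom f = {x. f x < \<infinity>}"

definition ereal_epigraph :: "('a \<Rightarrow> ereal) \<Rightarrow> ('a \<times> real) set" where
  "ereal_epigraph f = {(x, r). f x \<le> ereal r}"

definition proper_fun :: "('a \<Rightarrow> ereal) \<Rightarrow> bool" where
  "proper_fun f \<longleftrightarrow> (\<forall>x. f x \<noteq> -\<infinity>) \<and> (\<exists>x. f x \<noteq> \<infinity>)"

definition closed_fun :: "('a::topological_space \<Rightarrow> ereal) \<Rightarrow> bool" where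
  "closed_fun f \<longleftrightarrow> closed (ereal_epigraph f)"

definition convex_fun :: "('a::real_vector \<Rightarrow> ereal) \<Rightarrow> bool" where
  "convex_fun f \<longleftrightarrow> convex (ereal_epigraph f)"

definition sym_pos_def :: "real^'n^'n \<Rightarrow> bool" where
  "sym_pos_def M \<longleftrightarrow> transpose M = M \<and> (\<forall>v. v \<noteq> 0 \<longrightarrow> v \<bullet> (M *v v) > 0)"

definition mat_norm :: "real^'n^'n \<Rightarrow> real^'n \<Rightarrow> real" where
  "mat_norm M v = sqrt (v \<bullet> (M *v v))"

definition real_eigenvalue :: "real^'n^'n \<Rightarrow> real \<Rightarrow> bool" where
  "real_eigenvalue M l \<longleftrightarrow> (\<exists>v. v \<noteq> 0 \<and> M *v v = l *\<^sub>R v)"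

definition lambda_min :: "real^'n^'n \<Rightarrow> real" where
  "lambda_min M = (LEAST l. real_eigenvalue M l)"

definition Phi :: "(real^'q \<Rightarrow> ereal) \<Rightarrow> (real^'p \<Rightarrow> ereal) \<Rightarrow> real^'q \<Rightarrow> real^'p \<Rightarrow> ereal" where
  "Phi g f x w = g x + f w"

definition lagrangian ::
  "(real^'q \<Rightarrow> ereal) \<Rightarrow> (real^'p \<Rightarrow> ereal) \<Rightarrow> real^'q^'m \<Rightarrow> real^'p^'m \<Rightarrow> real^'m
    \<Rightarrow> real^'q \<Rightarrow> real^'p \<Rightarrow> real^'m \<Rightarrow> ereal" where
  "lagrangian g f A B b x w y = Phi g f x w + ereal (y \<bullet> (A *v x + B *v w - b))"

definition aug_lagrangian ::
  "(real^'q \<Rightarrow> ereal) \<Rightarrow> (real^'p \<Rightarrow> ereal) \<Rightarrow> real^'q^'m \<Rightarrow> real^'p^'m \<Rightarrow> real^'m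
    \<Rightarrow> real \<Rightarrow> real^'q \<Rightarrow> real^'p \<Rightarrow> real^'m \<Rightarrow> ereal" where
  "aug_lagrangian g f A B b \<sigma> x w y =
     lagrangian g f A B b x w y + ereal (\<sigma> / 2 * (norm (A *v x + B *v w - b))\<^sup>2)"

definition saddle_point ::
  "(real^'q \<Rightarrow> ereal) \<Rightarrow> (real^'p \<Rightarrow> ereal) \<Rightarrow> real^'q^'m \<Rightarrow> real^'p^'m \<Rightarrow> real^'m
    \<Rightarrow> (real^'q) \<times> (real^'p) \<times> (real^'m) \<Rightarrow> bool" where
  "saddle_point g f A B b = (\<lambda>(xs, ws, ys). \<forall>x w y.
     lagrangian g f A B b xs ws y \<le> lagrangian g f A B b xs ws ys \<and>
     lagrangian g f A B b xs ws ys \<le> lagrangian g f A B b x w ys)"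

definition solution_set ::
  "(real^'q \<Rightarrow> ereal) \<Rightarrow> (real^'p \<Rightarrow> ereal) \<Rightarrow> real^'q^'m \<Rightarrow> real^'p^'m \<Rightarrow> real^'m
    \<Rightarrow> ((real^'q) \<times> (real^'p)) set" where
  "solution_set g f A B b =
     {z. is_arg_min (\<lambda>(x, w). Phi g f x w) (\<lambda>(x, w). A *v x + B *v w = b) z}"

definition standing_assumption ::
  "(real^'q \<Rightarrow> ereal) \<Rightarrow> (real^'p \<Rightarrow> ereal) \<Rightarrow> real^'q^'m \<Rightarrow> real^'p^'m \<Rightarrow> real^'m \<Rightarrow> bool" where
  "standing_assumption g f A B b \<longleftrightarrow>
     solution_set g f A B b \<noteq> {} \<and>
     (\<exists>x\<in>rel_interior (effective_dom g). \<exists>w\<in>rel_interior (effective_dom f).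
        A *v x + B *v w = b)"

text \<open>
  The \<open>x\<close>-subproblem minimises \<open>lagrangian\<close> plus a proximal term over \<open>x\<close>, where \<open>f w\<close> is an
  additive constant. The starting point \<open>w\<^sub>0\<close> is arbitrary, and if \<open>f w\<^sub>0 = \<infinity>\<close> the Lagrangian is
  identically \<open>\<infinity>\<close> in \<open>x\<close>, so that every \<open>x\<close> would be a minimiser. The constant is
  therefore omitted; \<open>x_objective_arg_min_iff\<close> shows that the minimisers are the same when
  \<open>f w\<close> is finite.
\<close>

definition x_objective ::
  "(real^'q \<Rightarrow> ereal) \<Rightarrow> real^'q^'m \<Rightarrow> real^'p^'m \<Rightarrow> real^'m \<Rightarrow> real^'q^'q
    \<Rightarrow> real \<Rightarrow> real^'q \<Rightarrow> real^'p \<Rightarrow> real^'m \<Rightarrow> real^'q \<Rightarrow> ereal" where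
  "x_objective g A B b S t u w y x =
     g x + ereal (y \<bullet> (A *v x + B *v w - b)) + ereal (1 / (2 * t) * (mat_norm S (x - u))\<^sup>2)"

lemma x_objective_arg_min_iff:
  assumes "\<bar>f w\<bar> \<noteq> \<infinity>"
  shows "is_arg_min (x_objective g A B b S t u w y) (\<lambda>_. True) x \<longleftrightarrow>
    is_arg_min (\<lambda>x. lagrangian g f A B b x w y + ereal (1 / (2 * t) * (mat_norm S (x - u))\<^sup>2))
      (\<lambda>_. True) x"
proof -
  from assms obtain c where c: "f w = ereal c" by auto
  have eq: "lagrangian g f A B b x w y + ereal (1 / (2 * t) * (mat_norm S (x - u))\<^sup>2)
      = x_objective g A B b S t u w y x + ereal c" for x
    unfolding lagrangian_def Phi_def x_objective_def c by (cases "g x") auto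
  have less: "(a + ereal c < a' + ereal c) = (a < a')" for a a' :: ereal
    by (cases a; cases a') auto
  show ?thesis unfolding is_arg_min_def eq less ..
qed

definition w_objective ::
  "(real^'q \<Rightarrow> ereal) \<Rightarrow> (real^'p \<Rightarrow> ereal) \<Rightarrow> real^'q^'m \<Rightarrow> real^'p^'m \<Rightarrow> real^'m \<Rightarrow> real^'p^'p
    \<Rightarrow> real \<Rightarrow> real^'p \<Rightarrow> real^'q \<Rightarrow> real^'m \<Rightarrow> real^'p \<Rightarrow> ereal" where
  "w_objective g f A B b T \<sigma> w' x y w =
     aug_lagrangian g f A B b \<sigma> x w y + ereal (1 / 2 * (mat_norm T (w - w'))\<^sup>2)"

text \<open>
  The initial values are \<open>x 0\<close>, \<open>w 0\<close>, \<open>y 0\<close>, \<open>\<tau> 0\<close>.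
\<close>

definition generated_by_algorithm ::
  "(real^'q \<Rightarrow> ereal) \<Rightarrow> (real^'p \<Rightarrow> ereal) \<Rightarrow> real^'q^'m \<Rightarrow> real^'p^'m \<Rightarrow> real^'m
    \<Rightarrow> real^'q^'q \<Rightarrow> real^'p^'p \<Rightarrow> real \<Rightarrow> real \<Rightarrow> real
    \<Rightarrow> (nat \<Rightarrow> real^'q) \<Rightarrow> (nat \<Rightarrow> real^'q) \<Rightarrow> (nat \<Rightarrow> real^'p) \<Rightarrow> (nat \<Rightarrow> real^'m)
    \<Rightarrow> (nat \<Rightarrow> real) \<Rightarrow> bool" where
  "generated_by_algorithm g f A B b S T \<psi> \<beta> \<mu> u x w y \<tau> \<longleftrightarrow>
     u 0 = x 0 \<and>
     (\<forall>k\<ge>1.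
        u k = ((\<psi> - 1) / \<psi>) *\<^sub>R x (k - 1) + (1 / \<psi>) *\<^sub>R u (k - 1) \<and>
        is_arg_min (x_objective g A B b S (\<tau> (k - 1)) (u k) (w (k - 1)) (y (k - 1)))
          (\<lambda>_. True) (x k) \<and>
        \<tau> k = (if A *v x k = A *v x (k - 1) then \<tau> (k - 1)
               else let L = norm (A *v x k - A *v x (k - 1)) / norm (x k - x (k - 1))
                    in min (\<tau> (k - 1)) (\<mu> * sqrt (lambda_min S) / (sqrt \<beta> * L))) \<and>
        is_arg_min (w_objective g f A B b T (\<beta> * \<tau> k) (w (k - 1)) (x k) (y (k - 1)))
          (\<lambda>_. True) (w k) \<and>
        y k = y (k - 1) + (\<beta> * \<tau> k) *\<^sub>R (A *v x k + B *v w k - b))"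

end

theory Submission
  imports Defs
begin

text \<open>
  Fix a saddle point \<open>(x*, w*, y*)\<close> and consider the energy
  \<open>E k = \<psi>/(\<psi>-1) \<bar>u (k+2) - x*\<bar>\<^sub>S\<^sup>2 + \<bar>y k - y*\<bar>\<^sup>2/\<beta> + \<tau> k \<bar>w k - w*\<bar>\<^sub>T\<^sup>2\<close>.
  Adding the optimality conditions of two successive \<open>x\<close>-steps (the later one tested at \<open>x*\<close>,
  the earlier one at the later iterate), that of the \<open>w\<close>-step, and the saddle inequalities shows
  that \<open>E k - E (k+1)\<close> dominates a quadratic form in the increments of \<open>x\<close> and \<open>y\<close> and the gap \<open>x - u\<close>.
  Since \<open>\<tau>\<close> is nonincreasing with a positive limit, its coefficients converge, and the limit form
  is positive definite iff \<open>\<mu>\<^sup>2 < K\<close> with \<open>K = \<psi> (2 + 2 \<psi> - \<psi>\<^sup>2) / (\<psi> + 1)\<close>. This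
  follows from \<open>\<mu> < K/2\<close> because \<open>K < 4\<close>.
  Hence the energy converges and the increments vanish; closedness of the epigraphs makes every
  cluster point a saddle point, and the energy relative to a cluster point tends to \<open>0\<close>.
\<close>

section \<open>Quadratic forms of positive definite matrices\<close>

abbreviation quad :: "real^'n^'n \<Rightarrow> real^'n \<Rightarrow> real" where
  "quad M v \<equiv> v \<bullet> (M *v v)"

lemma sym_pos_def_commute:
  assumes "sym_pos_def M"
  shows "v \<bullet> (M *v w) = w \<bullet> (M *v v)"
  using assms unfolding sym_pos_def_def
  by (metis dot_lmul_matrix inner_commute transpose_matrix_vector)

lemma quad_nonneg: "sym_pos_def M \<Longrightarrow> 0 \<le> quad M v"
  unfolding sym_pos_def_def by (cases "v = 0") (auto simp: less_imp_le)

lemma mat_norm_power2: "sym_pos_def M \<Longrightarrow> (mat_norm M v)\<^sup>2 = quad M v"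
  by (simp add: mat_norm_def quad_nonneg)

lemma matrix_vector_mult_minus_right: "(M :: real^'n^'m) *v (- v) = - (M *v v)"
  by (simp add: linear_neg)

lemma quad_lincomb:
  assumes "sym_pos_def M"
  shows "quad M (s *\<^sub>R v + t *\<^sub>R w) = s\<^sup>2 * quad M v + 2 * s * t * (v \<bullet> (M *v w)) + t\<^sup>2 * quad M w"
  using sym_pos_def_commute[OF assms, of w v]
  by (simp add: matrix_vector_right_distrib inner_add_left inner_add_right matrix_vector_mult_scaleR
      algebra_simps power2_eq_square)

lemma quad_add:
  assumes "sym_pos_def M"
  shows "quad M (v + w) = quad M v + 2 * (v \<bullet> (M *v w)) + quad M w"
  using quad_lincomb[OF assms, of 1 v 1 w] by simp

lemma quad_diff:
  assumes "sym_pos_def M"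
  shows "quad M (v - w) = quad M v - 2 * (v \<bullet> (M *v w)) + quad M w"
  using quad_lincomb[OF assms, of 1 v "-1" w] by simp

text \<open>Expand \<open>quad M\<close> at \<open>-s v + t w\<close>, which is nonnegative, and
  divide by \<open>t\<close>. The factor \<open>s\<close> may have either sign, so mixed terms of
  unknown sign are covered.\<close>

lemma quad_young:
  assumes "sym_pos_def M" "t > 0"
  shows "2 * s * (v \<bullet> (M *v w)) \<le> t * quad M w + s\<^sup>2 / t * quad M v"
proof -
  have "0 \<le> quad M ((-s) *\<^sub>R v + t *\<^sub>R w) / t"
    using quad_nonneg[OF assms(1)] assms(2) by (metis divide_nonneg_pos)
  also have "\<dots> = s\<^sup>2 / t * quad M v - 2 * s * (v \<bullet> (M *v w)) + t * quad M w"
    unfolding quad_lincomb[OF assms(1)] using assms(2)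
    by (simp add: field_simps power2_eq_square)
  finally show ?thesis by simp
qed

lemma quad_continuous: "continuous_on UNIV (\<lambda>v. quad M v)"
  by (intro continuous_intros matrix_vector_mult_linear_continuous_on)

lemma quad_tendsto:
  assumes "(h \<longlongrightarrow> l) F"
  shows "((\<lambda>k. quad M (h k)) \<longlongrightarrow> quad M l) F"
  by (intro tendsto_inner assms matrix_vector_mul_linear[THEN linear_linear[THEN iffD2],
        THEN bounded_linear.tendsto])

text \<open>Compactness of the unit sphere gives a minimiser of the Rayleigh quotient, and the
  first-order condition there makes it an eigenvector. In particular the \<open>LEAST\<close> in
  \<open>lambda_min\<close> is attained.\<close>

lemma lambda_min_props:
  fixes M :: "real^'n^'n"
  assumes "sym_pos_def M"
  shows lambda_min_pos: "0 < lambda_min M"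
    and lambda_min_le_quad: "lambda_min M * (norm v)\<^sup>2 \<le> quad M v"
proof -
  have "sphere (0::real^'n) 1 \<noteq> {}" by simp
  moreover have "continuous_on (sphere 0 1) (\<lambda>v. quad M v)"
    using quad_continuous continuous_on_subset by blast
  ultimately obtain v0 where v0: "v0 \<in> sphere 0 1"
    and min0: "\<And>v. v \<in> sphere 0 1 \<Longrightarrow> quad M v0 \<le> quad M v"
    using continuous_attains_inf[OF compact_sphere] by blast
  define l where "l = quad M v0"
  have n0: "norm v0 = 1" using v0 by simp
  have "v0 \<noteq> 0" using n0 by auto
  then have lpos: "l > 0" using assms unfolding sym_pos_def_def l_def by blast
  have low: "l * (norm v)\<^sup>2 \<le> quad M v" for v
  proof (cases "v = 0")
    case False
    have "l \<le> quad M ((1 / norm v) *\<^sub>R v)"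
      unfolding l_def using False by (intro min0) simp
    then show ?thesis using False
      by (simp add: matrix_vector_mult_scaleR field_simps power2_eq_square)
  qed simp
  \<comment> \<open>The form \<open>quad M h - l \<bar>h\<bar>\<^sup>2\<close> is nonnegative and vanishes at \<open>v0\<close>, hence so does its gradient.\<close>
  define r where "r = M *v v0 - l *\<^sub>R v0"
  have "r = 0"
  proof (rule ccontr)
    assume "r \<noteq> 0"
    define c where "c = quad M r - l * (r \<bullet> r)"
    have key: "0 \<le> 2 * t * (r \<bullet> r) + t\<^sup>2 * c" for t
    proof -
      have "l * (norm (1 *\<^sub>R v0 + t *\<^sub>R r))\<^sup>2 \<le> quad M (1 *\<^sub>R v0 + t *\<^sub>R r)" by (rule low)
      moreover have "(norm (1 *\<^sub>R v0 + t *\<^sub>R r))\<^sup>2 = 1 + 2 * t * (v0 \<bullet> r) + t\<^sup>2 * (r \<bullet> r)"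
        unfolding power2_norm_eq_inner using n0
        by (simp add: inner_add_left inner_add_right inner_commute algebra_simps power2_eq_square
            norm_eq_1)
      moreover have "v0 \<bullet> (M *v r) - l * (v0 \<bullet> r) = r \<bullet> r"
        using sym_pos_def_commute[OF assms, of v0 r] n0
        by (simp add: r_def inner_diff_right inner_diff_left inner_commute norm_eq_1 algebra_simps)
      ultimately show ?thesis
        unfolding quad_lincomb[OF assms] c_def l_def[symmetric] by (auto simp: algebra_simps)
    qed
    have rr: "r \<bullet> r > 0" using \<open>r \<noteq> 0\<close> by simp
    \<comment> \<open>A negative step so short that the linear term wins:
      \<open>\<bar>t * c\<bar>\<close> is at most \<open>r \<bullet> r\<close>, which is less than
      \<open>2 * (r \<bullet> r)\<close>. The \<open>+ 1\<close> covers
      \<open>c = 0\<close>.\<close>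
    define t where "t = - (r \<bullet> r) / (\<bar>c\<bar> + 1)"
    have "t < 0" unfolding t_def using rr by (simp add: field_simps)
    moreover have "t * c \<ge> - (r \<bullet> r)"
    proof -
      have "\<bar>t * c\<bar> = (r \<bullet> r) * (\<bar>c\<bar> / (\<bar>c\<bar> + 1))" unfolding t_def using rr by (simp add: abs_mult)
      also have "\<dots> \<le> (r \<bullet> r) * 1" using rr by (intro mult_left_mono) auto
      finally show ?thesis by linarith
    qed
    then have "2 * (r \<bullet> r) + t * c > 0" using rr by linarith
    ultimately have "t * (2 * (r \<bullet> r) + t * c) < 0" by (rule mult_neg_pos)
    then show False using key[of t] by (simp add: algebra_simps power2_eq_square)
  qed
  then have eig: "real_eigenvalue M l"
    unfolding real_eigenvalue_def r_def using n0 by (intro exI[of _ v0]) auto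
  have "lambda_min M = l"
    unfolding lambda_min_def
  proof (rule Least_equality[where P = "real_eigenvalue M", OF eig])
    fix l' assume "real_eigenvalue M l'"
    then obtain v where v: "v \<noteq> 0" "M *v v = l' *\<^sub>R v" unfolding real_eigenvalue_def by blast
    then have "l * (norm v)\<^sup>2 \<le> l' * (norm v)\<^sup>2" using low[of v] by (simp add: power2_norm_eq_inner)
    then show "l \<le> l'" using v(1) by simp
  qed
  then show "0 < lambda_min M" "lambda_min M * (norm v)\<^sup>2 \<le> quad M v" using lpos low by simp_all
qed

section \<open>Minimisers of convex plus quadratic functions\<close>

lemma convex_funD:
  assumes "convex_fun h" "h a \<le> ereal r" "h c \<le> ereal s" "0 \<le> t" "t \<le> 1"
  shows "h ((1 - t) *\<^sub>R a + t *\<^sub>R c) \<le> ereal ((1 - t) * r + t * s)"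
proof -
  have "(1 - t) *\<^sub>R (a, r) + t *\<^sub>R (c, s) \<in> ereal_epigraph h"
    using assms unfolding convex_fun_def
    by (intro convexD) (auto simp: ereal_epigraph_def)
  then show ?thesis by (simp add: ereal_epigraph_def)
qed

text \<open>Lower semicontinuity, phrased with moving upper bounds so that inequalities along the
  iteration pass to the limit.\<close>

lemma closed_funD:
  assumes "closed_fun h" "a \<longlonglongrightarrow> a'" "r \<longlonglongrightarrow> r'" "\<And>k. h (a k) \<le> ereal (r k)"
  shows "h a' \<le> ereal r'"
proof -
  have "(a', r') \<in> ereal_epigraph h"
  proof (rule closed_sequentially)
    show "closed (ereal_epigraph h)" using assms(1) unfolding closed_fun_def .
    show "(\<lambda>k. (a k, r k)) \<longlonglongrightarrow> (a', r')" using assms(2,3) by (rule tendsto_Pair)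
  qed (simp add: ereal_epigraph_def assms(4))
  then show ?thesis by (simp add: ereal_epigraph_def)
qed

lemma arg_min_finite:
  fixes h :: "'a::real_vector \<Rightarrow> ereal"
  assumes "proper_fun h" "is_arg_min (\<lambda>v. h v + ereal (q v)) (\<lambda>_. True) v"
  shows "\<bar>h v\<bar> \<noteq> \<infinity>"
proof
  assume "\<bar>h v\<bar> = \<infinity>"
  then have "h v = \<infinity>" using assms(1) unfolding proper_fun_def by (cases "h v") auto
  moreover obtain a where "h a \<noteq> \<infinity>" using assms(1) unfolding proper_fun_def by blast
  then have "h a + ereal (q a) < \<infinity>" by simp
  ultimately show False using assms(2) unfolding is_arg_min_def by auto
qed

text \<open>Compare \<open>v\<close> with the points \<open>v + s (z - v)\<close>: convexity bounds
  \<open>h\<close> there and \<open>q\<close> is known exactly. Dividing by \<open>s\<close> and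
  letting \<open>s\<close> tend to \<open>0\<close> leaves only the slope \<open>c\<close>, the
  directional derivative of \<open>q\<close>.\<close>

lemma arg_min_variational:
  fixes h :: "'a::real_vector \<Rightarrow> ereal"
  assumes "proper_fun h" "convex_fun h" and min: "is_arg_min (\<lambda>v. h v + ereal (q v)) (\<lambda>_. True) v"
    and q: "\<And>s. q (v + s *\<^sub>R (z - v)) = q v + s * c + s\<^sup>2 * d"
  shows "h v \<le> h z + ereal c"
proof (cases "h z")
  case (real \<zeta>)
  obtain \<xi> where \<xi>: "h v = ereal \<xi>" using arg_min_finite[OF assms(1) min] by auto
  have ineq: "\<xi> \<le> \<zeta> + c + s * d" if s: "0 < s" "s \<le> 1" for s
  proof -
    define v' where "v' = v + s *\<^sub>R (z - v)"
    have v'_eq: "v' = (1 - s) *\<^sub>R v + s *\<^sub>R z" by (simp add: v'_def algebra_simps)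
    have "h v' \<le> ereal ((1 - s) * \<xi> + s * \<zeta>)"
      unfolding v'_eq using s by (intro convex_funD[OF assms(2)]) (auto simp: \<xi> real)
    moreover have "h v + ereal (q v) \<le> h v' + ereal (q v')"
      using min unfolding is_arg_min_def by (simp add: not_less)
    moreover have "h v' \<noteq> -\<infinity>" using assms(1) unfolding proper_fun_def by blast
    ultimately have "\<xi> + q v \<le> (1 - s) * \<xi> + s * \<zeta> + q v'" unfolding \<xi> by (cases "h v'") auto
    then have "s * \<xi> \<le> s * (\<zeta> + c + s * d)"
      unfolding v'_def q by (simp add: algebra_simps power2_eq_square)
    then show ?thesis using s by simp
  qed
  have "((\<lambda>s. \<zeta> + c + s * d) \<longlongrightarrow> \<zeta> + c + 0 * d) (at_right 0)" by (intro tendsto_intros)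
  moreover have "eventually (\<lambda>s. \<xi> \<le> \<zeta> + c + s * d) (at_right 0)"
    using ineq by (auto simp: eventually_at_right_field intro!: exI[of _ 1])
  ultimately have "\<xi> \<le> \<zeta> + c + 0 * d" by (intro tendsto_lowerbound) auto
  then show ?thesis by (simp add: \<xi> real)
next
  case MInf
  then show ?thesis using assms(1) unfolding proper_fun_def by auto
qed simp

section \<open>Saddle points\<close>

text \<open>The last two assumptions say that \<open>- (transpose A *v ys)\<close> and
  \<open>- (transpose B *v ys)\<close> are subgradients of \<open>g\<close> and \<open>f\<close>.
  Their sum is the minimality half; feasibility makes the Lagrangian at \<open>(xs, ws)\<close>
  constant in the multiplier, which is the other half.\<close>

lemma saddle_pointI:
  assumes "proper_fun g" "proper_fun f" "A *v xs + B *v ws = b"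
    and "\<And>z. g xs \<le> g z + ereal (ys \<bullet> (A *v (z - xs)))"
    and "\<And>z. f ws \<le> f z + ereal (ys \<bullet> (B *v (z - ws)))"
  shows "saddle_point g f A B b (xs, ws, ys)"
proof -
  have "g xs + f ws + ereal (ys \<bullet> (A *v xs + B *v ws - b)) \<le>
      g z + f v + ereal (ys \<bullet> (A *v z + B *v v - b))" for z v
  proof -
    have "g xs + f ws \<le> (g z + ereal (ys \<bullet> (A *v (z - xs)))) + (f v + ereal (ys \<bullet> (B *v (v - ws))))"
      by (intro add_mono assms)
    also have "\<dots> = g z + f v + ereal (ys \<bullet> (A *v z + B *v v - b))"
      unfolding assms(3)[symmetric] using assms(1,2) unfolding proper_fun_def
      by (cases "g z"; cases "f v")
        (auto simp: matrix_vector_mult_diff_distrib inner_diff_right inner_add_right)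
    finally show ?thesis using assms(3) by simp
  qed
  then show ?thesis using assms(3) unfolding saddle_point_def lagrangian_def Phi_def by simp
qed

text \<open>Properness first yields finite values, so that they can be cancelled in
  \<open>ereal\<close>. Moving the multiplier by the residual then forces feasibility, and moving
  one primal variable at a time splits minimality into two subgradient inequalities.\<close>

lemma saddle_pointD:
  assumes "proper_fun g" "proper_fun f" "saddle_point g f A B b (xs, ws, ys)"
  shows saddle_point_finite_fst: "\<bar>g xs\<bar> \<noteq> \<infinity>"
    and saddle_point_finite_snd: "\<bar>f ws\<bar> \<noteq> \<infinity>"
    and saddle_point_feasible: "A *v xs + B *v ws = b"
    and saddle_point_fst: "g xs \<le> g z + ereal (ys \<bullet> (A *v (z - xs)))"
    and saddle_point_snd: "f ws \<le> f v + ereal (ys \<bullet> (B *v (v - ws)))"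
proof -
  have S: "g xs + f ws + ereal (y \<bullet> (A *v xs + B *v ws - b)) \<le> g xs + f ws + ereal (ys \<bullet> (A *v xs + B *v ws - b))"
    "g xs + f ws + ereal (ys \<bullet> (A *v xs + B *v ws - b)) \<le> g x + f w + ereal (ys \<bullet> (A *v x + B *v w - b))" for x w y
    using assms(3) unfolding saddle_point_def lagrangian_def Phi_def by auto
  obtain x0 w0 where "g x0 \<noteq> \<infinity>" "f w0 \<noteq> \<infinity>" using assms(1,2) unfolding proper_fun_def by blast
  then have "g x0 + f w0 + ereal (ys \<bullet> (A *v x0 + B *v w0 - b)) < \<infinity>" by simp
  then have "g xs + f ws + ereal (ys \<bullet> (A *v xs + B *v ws - b)) < \<infinity>" using S(2) le_less_trans by blast
  moreover have "g xs \<noteq> -\<infinity>" "f ws \<noteq> -\<infinity>" using assms(1,2) unfolding proper_fun_def by auto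
  ultimately show fin: "\<bar>g xs\<bar> \<noteq> \<infinity>" "\<bar>f ws\<bar> \<noteq> \<infinity>"
    by (cases "g xs"; cases "f ws"; simp)+
  then obtain gs fs where gf: "g xs = ereal gs" "f ws = ereal fs" by auto
  define r where "r = A *v xs + B *v ws - b"
  have "(ys + r) \<bullet> r \<le> ys \<bullet> r" using S(1)[of "ys + r"] unfolding gf r_def[symmetric] by simp
  then have "r \<bullet> r \<le> 0" by (simp add: inner_add_left)
  then have "r = 0" by (simp add: inner_gt_zero_iff not_less[symmetric])
  then show feas: "A *v xs + B *v ws = b" unfolding r_def by simp
  show "g xs \<le> g z + ereal (ys \<bullet> (A *v (z - xs)))"
    using S(2)[of z ws] unfolding gf feas[symmetric]
    by (cases "g z") (auto simp: matrix_vector_mult_diff_distrib inner_diff_right inner_add_right)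
  show "f ws \<le> f v + ereal (ys \<bullet> (B *v (v - ws)))"
    using S(2)[of xs v] unfolding gf feas[symmetric]
    by (cases "f v") (auto simp: matrix_vector_mult_diff_distrib inner_diff_right inner_add_right)
qed

section \<open>Energy decrease along the iteration\<close>

text \<open>For \<open>\<epsilon> = 0\<close> the right side of the last inequality is
  \<open>K - \<mu>\<^sup>2 > 0\<close>, so a small positive \<open>\<epsilon>\<close> exists by
  continuity. The margin is \<open>2 * \<epsilon>\<close> because one \<open>\<epsilon>\<close> will
  be spent on step-size ratios that differ from \<open>1\<close>.\<close>

lemma coefficient_margin:
  fixes \<psi> \<mu> :: real
  assumes "1 < \<psi>" "0 < \<mu>" "\<mu> < \<psi> * (2 + 2 * \<psi> - \<psi>\<^sup>2) / (2 * (\<psi> + 1))"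
  defines "D \<equiv> 1 + 1 / \<psi>"
  obtains \<epsilon> where "0 < \<epsilon>" "2 * \<epsilon> < 1"
    "2 * \<epsilon> \<le> D - (\<psi> - D)\<^sup>2 / (D - 2 * \<epsilon>) - \<mu>\<^sup>2 / (1 - 2 * \<epsilon>)"
proof -
  define K where "K = \<psi> * (2 + 2 * \<psi> - \<psi>\<^sup>2) / (\<psi> + 1)"
  have D: "D > 1" unfolding D_def using assms(1) by simp
  have DK: "D - (\<psi> - D)\<^sup>2 / D = K"
  proof -
    have D': "D = (\<psi> + 1) / \<psi>" "\<psi> - D = (\<psi>\<^sup>2 - \<psi> - 1) / \<psi>"
      unfolding D_def using assms(1) by (simp_all add: field_simps power2_eq_square)
    have "D - (\<psi> - D)\<^sup>2 / D = ((\<psi> + 1)\<^sup>2 - (\<psi>\<^sup>2 - \<psi> - 1)\<^sup>2) / (\<psi> * (\<psi> + 1))"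
      unfolding D'(2) unfolding D'(1) using assms(1)
      by (simp add: divide_simps) (simp add: algebra_simps power2_eq_square)
    also have "(\<psi> + 1)\<^sup>2 - (\<psi>\<^sup>2 - \<psi> - 1)\<^sup>2 = \<psi> * (\<psi> * (2 + 2 * \<psi> - \<psi>\<^sup>2))"
      by (simp add: algebra_simps power2_eq_square)
    finally show ?thesis unfolding K_def using assms(1) by simp
  qed
  have \<mu>K: "\<mu> < K / 2" using assms(3) unfolding K_def by (simp add: mult.commute)
  have "K = (3 - (\<psi> - 1)\<^sup>2) * (\<psi> / (\<psi> + 1))"
  proof -
    have "2 + 2 * \<psi> - \<psi>\<^sup>2 = 3 - (\<psi> - 1)\<^sup>2" by (simp add: power2_eq_square algebra_simps)
    then show ?thesis unfolding K_def by simp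
  qed
  also have "\<dots> \<le> 3 * (\<psi> / (\<psi> + 1))" using assms(1) by (intro mult_right_mono) auto
  also have "\<dots> < 4" using assms(1) by (simp add: field_simps)
  finally have "\<mu> < 2" using \<mu>K by simp
  then have "\<mu> * \<mu> < 2 * (K / 2)" using \<mu>K assms(2) by (intro mult_strict_mono) auto
  then have pos: "D - (\<psi> - D)\<^sup>2 / D - \<mu>\<^sup>2 > 0" unfolding DK by (simp add: power2_eq_square)
  have "((\<lambda>\<epsilon>. D - (\<psi> - D)\<^sup>2 / (D - 2 * \<epsilon>) - \<mu>\<^sup>2 / (1 - 2 * \<epsilon>) - 2 * \<epsilon>)
      \<longlongrightarrow> D - (\<psi> - D)\<^sup>2 / (D - 2 * 0) - \<mu>\<^sup>2 / (1 - 2 * 0) - 2 * 0) (at_right 0)"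
    using D by (intro tendsto_intros) auto
  then have "eventually (\<lambda>\<epsilon>. D - (\<psi> - D)\<^sup>2 / (D - 2 * \<epsilon>) - \<mu>\<^sup>2 / (1 - 2 * \<epsilon>) - 2 * \<epsilon> > 0) (at_right 0)"
    using pos by (intro order_tendstoD(1)) auto
  moreover have "eventually (\<lambda>\<epsilon>::real. \<epsilon> \<in> {0<..<1/2}) (at_right 0)"
    by (rule eventually_at_right_real) simp
  ultimately have "eventually (\<lambda>\<epsilon>. \<epsilon> \<in> {0<..<1/2} \<and>
      D - (\<psi> - D)\<^sup>2 / (D - 2 * \<epsilon>) - \<mu>\<^sup>2 / (1 - 2 * \<epsilon>) - 2 * \<epsilon> > 0) (at_right 0)"
    by eventually_elim simp
  then obtain \<epsilon> where "\<epsilon> \<in> {0<..<1/2}"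
    "D - (\<psi> - D)\<^sup>2 / (D - 2 * \<epsilon>) - \<mu>\<^sup>2 / (1 - 2 * \<epsilon>) - 2 * \<epsilon> > 0"
    using eventually_happens'[of "at_right (0::real)"] by auto
  then show thesis by (intro that[of \<epsilon>]) auto
qed

text \<open>Here \<open>\<delta>\<close> and \<open>\<rho>\<close> stand for ratios of successive
  step sizes and \<open>X\<close> for the coupling of the multiplier with \<open>A\<close>. For
  \<open>\<delta> = \<rho> = 1\<close> the mixed term has coefficient
  \<open>- 2 * (\<psi> - D)\<close>; Young's inequality absorbs it, a completed square absorbs the
  coupling, and each square keeps weight \<open>2 * \<epsilon>\<close>. The deviation of the ratios
  from \<open>1\<close> costs at most \<open>\<epsilon>\<close> per square by
  \<open>small\<close>.\<close>

lemma quad_form_lower_bound: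
  fixes \<psi> \<mu> \<epsilon> \<delta> \<rho> z :: real
  assumes S: "sym_pos_def S" and D: "D > 1" and \<epsilon>: "0 < \<epsilon>" "2 * \<epsilon> < 1"
    and margin: "2 * \<epsilon> \<le> D - (\<psi> - D)\<^sup>2 / (D - 2 * \<epsilon>) - \<mu>\<^sup>2 / (1 - 2 * \<epsilon>)"
    and "0 \<le> \<mu>" "0 \<le> \<psi>" "\<delta> \<le> 1" "1 \<le> \<rho>"
    and small: "(1 - \<delta>) * \<psi> + (\<rho> - 1) * \<mu> \<le> \<epsilon>"
    and X: "X \<ge> - (2 * \<rho> * \<mu> * z * sqrt (quad S v))"
  shows "\<epsilon> * (quad S v + quad S c + z\<^sup>2)
    \<le> D * quad S (v + c) - 2 * \<delta> * \<psi> * (v \<bullet> (S *v c)) + z\<^sup>2 + X"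
proof -
  define p where "p = sqrt (quad S v)"
  define e where "e = \<psi> - D"
  define h where "h = v \<bullet> (S *v c)"
  have p2: "quad S v = p\<^sup>2" unfolding p_def using quad_nonneg[OF S] by simp
  have e: "2 * e * h \<le> (D - 2 * \<epsilon>) * quad S c + e\<^sup>2 / (D - 2 * \<epsilon>) * p\<^sup>2"
    using quad_young[OF S, of "D - 2 * \<epsilon>" e v c] D \<epsilon> unfolding p2 h_def by simp
  have "0 \<le> quad S (v + c)" by (rule quad_nonneg[OF S])
  then have "- (2 * h) \<le> p\<^sup>2 + quad S c" unfolding quad_add[OF S] p2 h_def by simp
  then have d: "(1 - \<delta>) * \<psi> * (- (2 * h)) \<le> (1 - \<delta>) * \<psi> * (p\<^sup>2 + quad S c)"
    using assms by (intro mult_left_mono) auto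
  have "0 \<le> ((1 - 2 * \<epsilon>) * z - \<mu> * p)\<^sup>2 / (1 - 2 * \<epsilon>)" using \<epsilon> by simp
  also have "\<dots> = (1 - 2 * \<epsilon>) * z\<^sup>2 - 2 * \<mu> * z * p + \<mu>\<^sup>2 / (1 - 2 * \<epsilon>) * p\<^sup>2"
    using \<epsilon> by (simp add: field_simps power2_eq_square)
  finally have m: "2 * \<mu> * z * p \<le> (1 - 2 * \<epsilon>) * z\<^sup>2 + \<mu>\<^sup>2 / (1 - 2 * \<epsilon>) * p\<^sup>2" by simp
  have "2 * z * p \<le> z\<^sup>2 + p\<^sup>2" using sum_squares_bound[of z p] by simp
  then have r: "(\<rho> - 1) * \<mu> * (2 * z * p) \<le> (\<rho> - 1) * \<mu> * (z\<^sup>2 + p\<^sup>2)"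
    using assms by (intro mult_left_mono) auto
  have c0: "0 \<le> (1 - \<delta>) * \<psi>" "0 \<le> (\<rho> - 1) * \<mu>" using assms by auto
  have "2 * \<epsilon> * p\<^sup>2 \<le> (D - e\<^sup>2 / (D - 2 * \<epsilon>) - \<mu>\<^sup>2 / (1 - 2 * \<epsilon>)) * p\<^sup>2"
    using margin unfolding e_def by (intro mult_right_mono) auto
  moreover have "((1 - \<delta>) * \<psi> + (\<rho> - 1) * \<mu>) * p\<^sup>2 \<le> \<epsilon> * p\<^sup>2"
    using small by (intro mult_right_mono) auto
  moreover have "(1 - \<delta>) * \<psi> * quad S c \<le> \<epsilon> * quad S c"
    using small c0 quad_nonneg[OF S] by (intro mult_right_mono) auto
  moreover have "(\<rho> - 1) * \<mu> * z\<^sup>2 \<le> \<epsilon> * z\<^sup>2"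
    using small c0 by (intro mult_right_mono) auto
  moreover have "D * quad S (v + c) - 2 * \<delta> * \<psi> * h
      = D * p\<^sup>2 + D * quad S c - 2 * e * h - (1 - \<delta>) * \<psi> * (- (2 * h))"
    unfolding quad_add[OF S] p2 h_def e_def by (simp add: algebra_simps)
  ultimately show ?thesis
    using e d m r X[folded p_def] unfolding h_def[symmetric] p2
    by (simp only: algebra_simps)
qed

lemma tendsto_0_if_quad_tendsto_0:
  assumes M: "sym_pos_def M" and lim: "((\<lambda>k. quad M (h k)) \<longlongrightarrow> 0) F"
  shows "(h \<longlongrightarrow> 0) F"
proof -
  have "((\<lambda>k. sqrt (quad M (h k) / lambda_min M)) \<longlongrightarrow> sqrt (0 / lambda_min M)) F"
    using lambda_min_pos[OF M] by (intro tendsto_intros lim) auto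
  moreover have "norm (h k) \<le> sqrt (quad M (h k) / lambda_min M)" for k
    using lambda_min_le_quad[OF M, of "h k"] lambda_min_pos[OF M]
    by (intro real_le_rsqrt) (simp add: field_simps)
  ultimately show ?thesis by (intro Lim_null_comparison[of h]) auto
qed

text \<open>From some index on \<open>E\<close> decreases and is bounded below, hence converges;
  \<open>R\<close> is then squeezed between \<open>0\<close> and differences of consecutive values
  of \<open>E\<close>.\<close>

lemma decreasing_energy:
  fixes E R :: "nat \<Rightarrow> real"
  assumes "\<And>k. 0 \<le> E k" "\<And>k. 0 \<le> R k" "eventually (\<lambda>k. E (Suc k) + R k \<le> E k) sequentially"
  shows "convergent E" "R \<longlonglongrightarrow> 0"
proof -
  obtain N where N: "\<And>k. k \<ge> N \<Longrightarrow> E (Suc k) + R k \<le> E k"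
    using assms(3) unfolding eventually_sequentially by blast
  have "decseq (\<lambda>k. E (k + N))"
    using N assms(2) by (intro decseq_SucI) (metis add_Suc le_add2 le_add_same_cancel1 order_trans)
  then obtain L where L: "(\<lambda>k. E (k + N)) \<longlonglongrightarrow> L" using decseq_convergent assms(1) by blast
  then show "convergent E" unfolding convergent_def using LIMSEQ_offset by blast
  have "(\<lambda>k. E (k + N) - E (Suc k + N)) \<longlonglongrightarrow> L - L"
    using L LIMSEQ_Suc[OF L] by (intro tendsto_diff) auto
  then have diff: "(\<lambda>k. E (k + N) - E (Suc k + N)) \<longlonglongrightarrow> 0" by simp
  have "R (k + N) \<le> E (k + N) - E (Suc k + N)" for k
    using N[of "k + N"] by simp
  then have "(\<lambda>k. R (k + N)) \<longlonglongrightarrow> 0"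
    using assms(2) by (intro tendsto_sandwich[OF _ _ tendsto_const diff] always_eventually) auto
  then show "R \<longlonglongrightarrow> 0" by (rule LIMSEQ_offset)
qed

locale algorithm_run =
  fixes g :: "real^'q \<Rightarrow> ereal" and f :: "real^'p \<Rightarrow> ereal"
    and A :: "real^'q^'m" and B :: "real^'p^'m" and b :: "real^'m"
    and S :: "real^'q^'q" and T :: "real^'p^'p"
    and \<psi> \<beta> \<mu> :: real
    and u x :: "nat \<Rightarrow> real^'q" and w :: "nat \<Rightarrow> real^'p" and y :: "nat \<Rightarrow> real^'m"
    and \<tau> :: "nat \<Rightarrow> real"
  assumes g: "proper_fun g" "closed_fun g" "convex_fun g"
    and f: "proper_fun f" "closed_fun f" "convex_fun f"
    and S: "sym_pos_def S" and T: "sym_pos_def T"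
    and \<tau>0: "\<tau> 0 > 0" and \<beta>: "\<beta> > 0"
    and \<psi>: "1 < \<psi>"
    and \<mu>: "0 < \<mu>" "\<mu> < \<psi> * (2 + 2 * \<psi> - \<psi>\<^sup>2) / (2 * (\<psi> + 1))"
    and run: "generated_by_algorithm g f A B b S T \<psi> \<beta> \<mu> u x w y \<tau>"
begin

lemma u_Suc: "u (Suc k) = ((\<psi> - 1) / \<psi>) *\<^sub>R x k + (1 / \<psi>) *\<^sub>R u k"
  and x_Suc: "is_arg_min (x_objective g A B b S (\<tau> k) (u (Suc k)) (w k) (y k)) (\<lambda>_. True) (x (Suc k))"
  and \<tau>_Suc: "\<tau> (Suc k) = (if A *v x (Suc k) = A *v x k then \<tau> k
     else let L = norm (A *v x (Suc k) - A *v x k) / norm (x (Suc k) - x k)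
          in min (\<tau> k) (\<mu> * sqrt (lambda_min S) / (sqrt \<beta> * L)))"
  and w_Suc: "is_arg_min (w_objective g f A B b T (\<beta> * \<tau> (Suc k)) (w k) (x (Suc k)) (y k)) (\<lambda>_. True) (w (Suc k))"
  and y_Suc: "y (Suc k) = y k + (\<beta> * \<tau> (Suc k)) *\<^sub>R (A *v x (Suc k) + B *v w (Suc k) - b)"
  using run unfolding generated_by_algorithm_def by (metis One_nat_def Suc_le_mono diff_Suc_1 le0)+

section \<open>Step sizes\<close>

lemma \<tau>_Suc_le: "\<tau> (Suc k) \<le> \<tau> k"
  unfolding \<tau>_Suc by (simp add: Let_def)

text \<open>The local ratio \<open>L\<close> never exceeds an operator bound \<open>C\<close> of
  \<open>A\<close>, so the second argument of the minimum cannot fall below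
  \<open>l / (sqrt \<beta> * C)\<close>.\<close>

lemma \<tau>_bounded_below: obtains t where "t > 0" "\<And>k. t \<le> \<tau> k"
proof -
  obtain C where C: "C > 0" "\<And>v. norm (A *v v) \<le> norm v * C"
    using bounded_linear.pos_bounded[OF matrix_vector_mul_bounded_linear[of A]] by blast
  define l where "l = \<mu> * sqrt (lambda_min S)"
  have l: "l > 0" unfolding l_def using \<mu> lambda_min_pos[OF S] by simp
  define t where "t = min (\<tau> 0) (l / (sqrt \<beta> * C))"
  have "t \<le> \<tau> k" for k
  proof (induction k)
    case (Suc k)
    show ?case
    proof (cases "A *v x (Suc k) = A *v x k")
      case False
      define L where "L = norm (A *v x (Suc k) - A *v x k) / norm (x (Suc k) - x k)"
      have "norm (A *v (x (Suc k) - x k)) \<le> norm (x (Suc k) - x k) * C" by (rule C)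
      moreover have "x (Suc k) \<noteq> x k" using False by auto
      ultimately have L: "0 < L" "L \<le> C"
        unfolding L_def using False by (simp_all add: matrix_vector_mult_diff_distrib field_simps)
      then have "l / (sqrt \<beta> * C) \<le> l / (sqrt \<beta> * L)"
        using l \<beta> C by (intro divide_left_mono mult_left_mono mult_pos_pos) auto
      then show ?thesis using False Suc unfolding \<tau>_Suc t_def l_def L_def by (auto simp: Let_def)
    qed (use Suc \<tau>_Suc in simp)
  qed (simp add: t_def)
  moreover have "t > 0" unfolding t_def using \<tau>0 l \<beta> C by simp
  ultimately show thesis using that by blast
qed

lemma \<tau>_pos: "\<tau> k > 0"
  using \<tau>_bounded_below by (metis less_le_trans)

lemma \<tau>_lim: obtains t where "t > 0" "\<tau> \<longlonglongrightarrow> t"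
proof -
  obtain t where t: "t > 0" "\<And>k. t \<le> \<tau> k" using \<tau>_bounded_below by blast
  have "decseq \<tau>" by (intro decseq_SucI \<tau>_Suc_le)
  then obtain L where L: "\<tau> \<longlonglongrightarrow> L" using t(2) decseq_convergent by blast
  moreover have "t \<le> L" using L t(2) by (intro LIMSEQ_le_const) auto
  ultimately show thesis using that[of L] t(1) by simp
qed

text \<open>This is what the step-size rule is designed for: its factor
  \<open>sqrt (lambda_min S)\<close> trades the Euclidean norm of the increment for the norm induced
  by \<open>S\<close>.\<close>

lemma \<tau>_norm_A:
  "\<tau> (Suc k) * norm (A *v (x (Suc k) - x k)) \<le> \<mu> / sqrt \<beta> * sqrt (quad S (x (Suc k) - x k))"
proof -
  define n where "n = norm (x (Suc k) - x k)"
  have "lambda_min S * n\<^sup>2 \<le> quad S (x (Suc k) - x k)" unfolding n_def by (rule lambda_min_le_quad[OF S])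
  then have "sqrt (lambda_min S * n\<^sup>2) \<le> sqrt (quad S (x (Suc k) - x k))" by simp
  then have 1: "sqrt (lambda_min S) * n \<le> sqrt (quad S (x (Suc k) - x k))"
    unfolding n_def by (simp add: real_sqrt_mult)
  have "\<tau> (Suc k) * norm (A *v (x (Suc k) - x k)) \<le> \<mu> / sqrt \<beta> * (sqrt (lambda_min S) * n)"
  proof (cases "A *v x (Suc k) = A *v x k")
    case True
    then show ?thesis using \<mu> \<beta> lambda_min_pos[OF S] by (simp add: matrix_vector_mult_diff_distrib n_def)
  next
    case False
    define N where "N = norm (A *v (x (Suc k) - x k))"
    have N: "N > 0" using False unfolding N_def by (simp add: matrix_vector_mult_diff_distrib)
    have n: "n > 0" using False unfolding n_def by auto
    have "\<tau> (Suc k) \<le> \<mu> * sqrt (lambda_min S) / (sqrt \<beta> * (N / n))"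
      using False unfolding \<tau>_Suc N_def n_def by (simp add: Let_def matrix_vector_mult_diff_distrib)
    then have "\<tau> (Suc k) * N \<le> \<mu> * sqrt (lambda_min S) / (sqrt \<beta> * (N / n)) * N"
      using N by (intro mult_right_mono) auto
    also have "\<dots> = \<mu> / sqrt \<beta> * (sqrt (lambda_min S) * n)" using N n \<beta> by simp
    finally show ?thesis unfolding N_def .
  qed
  also have "\<dots> \<le> \<mu> / sqrt \<beta> * sqrt (quad S (x (Suc k) - x k))"
    using 1 \<mu> \<beta> by (intro mult_left_mono) auto
  finally show ?thesis .
qed

section \<open>Optimality conditions of the two subproblems\<close>

lemma x_objective_eq:
  "x_objective g A B b S t v w' y' = (\<lambda>x. g x + ereal (y' \<bullet> (A *v x + B *v w' - b) + 1 / (2 * t) * quad S (x - v)))"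
proof
  show "x_objective g A B b S t v w' y' x = g x + ereal (y' \<bullet> (A *v x + B *v w' - b) + 1 / (2 * t) * quad S (x - v))" for x
    unfolding x_objective_def mat_norm_power2[OF S] by (cases "g x") auto
qed

lemma g_x_finite: "\<bar>g (x (Suc k))\<bar> \<noteq> \<infinity>"
  using arg_min_finite[OF g(1) x_Suc[unfolded x_objective_eq]] .

text \<open>\<open>arg_min_variational\<close> with the exact expansion of the linear and proximal
  terms along the segment from \<open>x (Suc k)\<close> to \<open>z\<close>.\<close>

lemma x_variational:
  "g (x (Suc k)) \<le> g z + ereal (y k \<bullet> (A *v (z - x (Suc k)))
     + 1 / \<tau> k * ((x (Suc k) - u (Suc k)) \<bullet> (S *v (z - x (Suc k)))))"
proof (rule arg_min_variational[OF g(1,3) x_Suc[unfolded x_objective_eq]])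
  fix s
  define v where "v = x (Suc k)"
  have eq: "v + s *\<^sub>R (z - v) - u (Suc k) = 1 *\<^sub>R (v - u (Suc k)) + s *\<^sub>R (z - v)" by simp
  have "quad S (v + s *\<^sub>R (z - v) - u (Suc k)) = quad S (v - u (Suc k))
     + 2 * s * ((v - u (Suc k)) \<bullet> (S *v (z - v))) + s\<^sup>2 * quad S (z - v)"
    unfolding eq quad_lincomb[OF S] by simp
  moreover have "y k \<bullet> (A *v (v + s *\<^sub>R (z - v)) + B *v w k - b)
      = y k \<bullet> (A *v v + B *v w k - b) + s * (y k \<bullet> (A *v (z - v)))"
    by (simp add: matrix_vector_right_distrib matrix_vector_mult_scaleR inner_add_right inner_diff_right algebra_simps)
  ultimately show "y k \<bullet> (A *v (x (Suc k) + s *\<^sub>R (z - x (Suc k))) + B *v w k - b) +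
         1 / (2 * \<tau> k) * quad S (x (Suc k) + s *\<^sub>R (z - x (Suc k)) - u (Suc k)) =
         y k \<bullet> (A *v x (Suc k) + B *v w k - b) + 1 / (2 * \<tau> k) * quad S (x (Suc k) - u (Suc k)) +
         s * (y k \<bullet> (A *v (z - x (Suc k))) + 1 / \<tau> k * ((x (Suc k) - u (Suc k)) \<bullet> (S *v (z - x (Suc k))))) +
         s\<^sup>2 * (1 / (2 * \<tau> k) * quad S (z - x (Suc k)))"
    unfolding v_def using \<tau>_pos[of k] by (simp add: field_simps)
qed

text \<open>The value of \<open>g\<close> at the new \<open>x\<close> is finite, since that point
  minimises its own subproblem. It is therefore a constant that cancels, leaving the form required
  by \<open>arg_min_variational\<close>.\<close>

lemma w_arg_min:
  fixes k
  defines "x' \<equiv> x (Suc k)" and "\<sigma> \<equiv> \<beta> * \<tau> (Suc k)"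
  shows "is_arg_min (\<lambda>v. f v + ereal (y k \<bullet> (A *v x' + B *v v - b)
      + \<sigma> / 2 * (norm (A *v x' + B *v v - b))\<^sup>2 + 1 / 2 * quad T (v - w k))) (\<lambda>_. True) (w (Suc k))"
proof -
  obtain c where c: "g x' = ereal c" unfolding x'_def using g_x_finite by fastforce
  have eq: "w_objective g f A B b T \<sigma> (w k) x' (y k) v = ereal c + (f v + ereal (y k \<bullet> (A *v x' + B *v v - b)
      + \<sigma> / 2 * (norm (A *v x' + B *v v - b))\<^sup>2 + 1 / 2 * quad T (v - w k)))" for v
    unfolding w_objective_def aug_lagrangian_def lagrangian_def Phi_def mat_norm_power2[OF T] c
    by (cases "f v") auto
  have less: "ereal c + r < ereal c + r' \<longleftrightarrow> r < r'" for r r' by (cases r; cases r') auto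
  show ?thesis using w_Suc[of k] unfolding is_arg_min_def x'_def[symmetric] \<sigma>_def[symmetric] eq less .
qed

lemma f_w_finite: "\<bar>f (w (Suc k))\<bar> \<noteq> \<infinity>"
  using arg_min_finite[OF f(1) w_arg_min] .

text \<open>The linear and penalty terms together have slope given by
  \<open>y k + \<sigma> r\<close>, which is the updated multiplier; hence \<open>y (Suc k)\<close>
  appears and no penalty term remains.\<close>

lemma w_variational:
  "f (w (Suc k)) \<le> f z + ereal (y (Suc k) \<bullet> (B *v (z - w (Suc k)))
     + (w (Suc k) - w k) \<bullet> (T *v (z - w (Suc k))))"
proof (rule arg_min_variational[OF f(1,3) w_arg_min])
  fix s
  define v where "v = w (Suc k)"
  define \<sigma> where "\<sigma> = \<beta> * \<tau> (Suc k)"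
  define r where "r = A *v x (Suc k) + B *v v - b"
  have eq: "v + s *\<^sub>R (z - v) - w k = 1 *\<^sub>R (v - w k) + s *\<^sub>R (z - v)" by simp
  have 1: "quad T (v + s *\<^sub>R (z - v) - w k) = quad T (v - w k)
     + 2 * s * ((v - w k) \<bullet> (T *v (z - v))) + s\<^sup>2 * quad T (z - v)"
    unfolding eq quad_lincomb[OF T] by simp
  have 2: "A *v x (Suc k) + B *v (v + s *\<^sub>R (z - v)) - b = r + s *\<^sub>R (B *v (z - v))"
    unfolding r_def by (simp add: matrix_vector_right_distrib matrix_vector_mult_scaleR)
  have 3: "y (Suc k) = y k + \<sigma> *\<^sub>R r" unfolding y_Suc r_def \<sigma>_def v_def ..
  show "y k \<bullet> (A *v x (Suc k) + B *v (w (Suc k) + s *\<^sub>R (z - w (Suc k))) - b) +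
         \<beta> * \<tau> (Suc k) / 2 * (norm (A *v x (Suc k) + B *v (w (Suc k) + s *\<^sub>R (z - w (Suc k))) - b))\<^sup>2 +
         1 / 2 * quad T (w (Suc k) + s *\<^sub>R (z - w (Suc k)) - w k) =
         y k \<bullet> (A *v x (Suc k) + B *v w (Suc k) - b) +
         \<beta> * \<tau> (Suc k) / 2 * (norm (A *v x (Suc k) + B *v w (Suc k) - b))\<^sup>2 +
         1 / 2 * quad T (w (Suc k) - w k) +
         s * (y (Suc k) \<bullet> (B *v (z - w (Suc k))) + (w (Suc k) - w k) \<bullet> (T *v (z - w (Suc k)))) +
         s\<^sup>2 * (\<sigma> / 2 * (norm (B *v (z - v)))\<^sup>2 + 1 / 2 * quad T (z - v))"
    unfolding v_def[symmetric] \<sigma>_def[symmetric] 1 2 3 r_def[symmetric] power2_norm_eq_inner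
    by (simp add: inner_add_left inner_add_right inner_commute algebra_simps power2_eq_square)
qed

section \<open>The energy and its decrease\<close>

lemma x_minus_u: "x k - u k = \<psi> *\<^sub>R (x k - u (Suc k))"
  unfolding u_Suc using \<psi> by (simp add: algebra_simps) (simp add: scaleR_diff_left diff_divide_distrib)

text \<open>The \<open>x\<close> quantities run one index ahead of \<open>dy\<close> and
  \<open>dw\<close>, because \<open>y (Suc k)\<close> enters the step that produces
  \<open>x (Suc (Suc k))\<close>.\<close>

abbreviation (input) "dx k \<equiv> x (Suc (Suc k)) - x (Suc k)"
abbreviation (input) "gap k \<equiv> x (Suc k) - u (Suc (Suc k))"
abbreviation (input) "dy k \<equiv> y (Suc k) - y k"
abbreviation (input) "dw k \<equiv> w (Suc k) - w k"

definition energy :: "real^'q \<Rightarrow> real^'p \<Rightarrow> real^'m \<Rightarrow> nat \<Rightarrow> real" where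
  "energy xs ws ys k = \<psi> / (\<psi> - 1) * quad S (u (Suc (Suc k)) - xs)
     + 1 / \<beta> * (norm (y k - ys))\<^sup>2 + \<tau> k * quad T (w k - ws)"

lemma energy_nonneg: "0 \<le> energy xs ws ys k"
  unfolding energy_def using \<psi> \<beta> \<tau>_pos[of k] quad_nonneg[OF S] quad_nonneg[OF T] by simp

lemma energy_step:
  assumes saddle: "saddle_point g f A B b (xs, ws, ys)"
  shows "energy xs ws ys (Suc k) \<le> energy xs ws ys k - (1 + 1 / \<psi>) * quad S (dx k + gap k)
     + 2 * (\<tau> (Suc k) / \<tau> k) * \<psi> * (dx k \<bullet> (S *v gap k)) - 1 / \<beta> * (norm (dy k))\<^sup>2
     - \<tau> (Suc k) * quad T (dw k) - 2 * \<tau> (Suc k) * (dy k \<bullet> (A *v dx k))"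
proof -
  note sp = saddle_pointD[OF g(1) f(1) saddle]
  define v where "v = dx k"
  define c where "c = gap k"
  define d where "d = x (Suc (Suc k)) - xs"
  define e where "e = w (Suc k) - ws"
  define p where "p = \<tau> (Suc k)"
  define r where "r = A *v x (Suc k) + B *v w (Suc k) - b"
  have p: "p > 0" unfolding p_def by (rule \<tau>_pos)
  obtain \<gamma>s \<gamma>1 \<gamma>2 \<phi>s \<phi>1 where vals: "g xs = ereal \<gamma>s" "g (x (Suc k)) = ereal \<gamma>1" "g (x (Suc (Suc k))) = ereal \<gamma>2"
    "f ws = ereal \<phi>s" "f (w (Suc k)) = ereal \<phi>1"
    using sp(1,2) g_x_finite[of k] g_x_finite[of "Suc k"] f_w_finite[of k] by auto
  have e1: "xs - x (Suc (Suc k)) = - d" "x (Suc (Suc k)) - u (Suc (Suc k)) = v + c"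
    "x (Suc k) - xs = d - v" "ws - w (Suc k) = - e"
    by (simp_all add: d_def v_def c_def e_def)
  \<comment> \<open>In the sum of \<open>1\<close> to \<open>5\<close> all function values cancel.
    In \<open>2\<close> the factor \<open>\<psi>\<close> arises from rewriting \<open>x - u\<close>
    as a multiple of the gap by \<open>x_minus_u\<close>.\<close>
  have 1: "\<gamma>2 \<le> \<gamma>s - y (Suc k) \<bullet> (A *v d) - 1 / p * ((v + c) \<bullet> (S *v d))"
    using x_variational[of "Suc k" xs] unfolding vals e1 p_def[symmetric] by (simp add: matrix_vector_mult_minus_right)
  have 2: "\<gamma>1 \<le> \<gamma>2 + y k \<bullet> (A *v v) + \<psi> / \<tau> k * (c \<bullet> (S *v v))"
    using x_variational[of k "x (Suc (Suc k))"] unfolding vals x_minus_u v_def[symmetric] c_def[symmetric] by simp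
  have 3: "\<phi>1 \<le> \<phi>s - y (Suc k) \<bullet> (B *v e) - dw k \<bullet> (T *v e)"
    using w_variational[of k ws] unfolding vals e1 by (simp add: matrix_vector_mult_minus_right)
  have 4: "\<gamma>s \<le> \<gamma>1 + ys \<bullet> (A *v (d - v))" using sp(4)[of "x (Suc k)"] unfolding vals e1 by simp
  have 5: "\<phi>s \<le> \<phi>1 + ys \<bullet> (B *v e)" using sp(5)[of "w (Suc k)"] unfolding vals e_def[symmetric] by simp
  have r: "r = A *v (d - v) + B *v e"
    unfolding r_def e1(3)[symmetric] e_def sp(3)[symmetric] by (simp add: matrix_vector_mult_diff_distrib)
  have "0 \<le> (ys - y (Suc k)) \<bullet> r - dy k \<bullet> (A *v v) - 1 / p * ((v + c) \<bullet> (S *v d))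
      + \<psi> / \<tau> k * (c \<bullet> (S *v v)) - dw k \<bullet> (T *v e)"
    using 1 2 3 4 5 unfolding r
    by (simp add: inner_diff_left inner_add_right inner_diff_right matrix_vector_mult_diff_distrib)
  \<comment> \<open>The factor \<open>2 * p\<close> clears the proximal denominator and turns the
    residual \<open>r\<close> into \<open>dy k / \<beta>\<close> through the multiplier
    update.\<close>
  then have "0 \<le> 2 * p * ((ys - y (Suc k)) \<bullet> r - dy k \<bullet> (A *v v) - 1 / p * ((v + c) \<bullet> (S *v d))
      + \<psi> / \<tau> k * (c \<bullet> (S *v v)) - dw k \<bullet> (T *v e))"
    using p by (intro mult_nonneg_nonneg) auto
  also have "\<dots> = 2 * ((ys - y (Suc k)) \<bullet> (p *\<^sub>R r)) - 2 * p * (dy k \<bullet> (A *v v)) - 2 * ((v + c) \<bullet> (S *v d))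
      + 2 * (p / \<tau> k) * \<psi> * (c \<bullet> (S *v v)) - 2 * p * (dw k \<bullet> (T *v e))"
    using p by (simp add: algebra_simps)
  also have "p *\<^sub>R r = (1 / \<beta>) *\<^sub>R dy k"
    using \<beta> unfolding y_Suc r_def p_def by simp
  finally have main: "0 \<le> 2 / \<beta> * ((ys - y (Suc k)) \<bullet> dy k) - 2 * p * (dy k \<bullet> (A *v v)) - 2 * (d \<bullet> (S *v (v + c)))
      + 2 * (p / \<tau> k) * \<psi> * (v \<bullet> (S *v c)) - 2 * p * (dw k \<bullet> (T *v e))"
    using sym_pos_def_commute[OF S, of "v + c" d] sym_pos_def_commute[OF S, of c v] by simp

  \<comment> \<open>Here \<open>u (k + 2) - xs = d - (v + c)\<close> and \<open>u (k + 3) - xs = d - (v + c) / \<psi>\<close>; the weight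
    \<open>\<psi> / (\<psi> - 1)\<close> is the one for which the mixed term cancels \<open>- 2 (d \<bullet> S (v + c))\<close> in \<open>main\<close>.\<close>
  define h where "h = d \<bullet> (S *v (v + c))"
  have u2: "u (Suc (Suc k)) - xs = d - (v + c)" by (simp add: d_def v_def c_def)
  have "x (Suc (Suc k)) - u (Suc (Suc (Suc k))) = (1 / \<psi>) *\<^sub>R (v + c)"
    using x_minus_u[of "Suc (Suc k)"] \<psi> unfolding e1 by simp
  then have u3: "u (Suc (Suc (Suc k))) - xs = d - (1 / \<psi>) *\<^sub>R (v + c)"
    unfolding d_def by (simp add: algebra_simps)
  define Q Q' Qd where "Q = quad S (v + c)" and "Q' = quad S (d - (1 / \<psi>) *\<^sub>R (v + c))"
    and "Qd = quad S d"
  have "Q' = Qd - 2 / \<psi> * h + Q / \<psi>\<^sup>2"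
    unfolding Q_def Q'_def Qd_def
    unfolding quad_diff[OF S] h_def by (simp add: matrix_vector_mult_scaleR power2_eq_square)
  moreover have "quad S (d - (v + c)) = Qd - 2 * h + Q"
    unfolding Q_def Qd_def h_def by (rule quad_diff[OF S])
  ultimately have "\<psi> / (\<psi> - 1) * Q' - \<psi> / (\<psi> - 1) * quad S (d - (v + c))
      = \<psi> / (\<psi> - 1) * (2 * (1 - 1 / \<psi>) * h - (1 - 1 / \<psi>\<^sup>2) * Q)"
    by (simp only: right_diff_distrib[symmetric]) (simp add: algebra_simps)
  also have "\<dots> = 2 * h - (1 + 1 / \<psi>) * Q"
  proof -
    have "\<psi> / (\<psi> - 1) * (1 - 1 / \<psi>) = 1" using \<psi> by (simp add: field_simps)
    moreover have "1 - 1 / \<psi>\<^sup>2 = (1 - 1 / \<psi>) * (1 + 1 / \<psi>)" by (simp add: algebra_simps power2_eq_square)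
    moreover have "i * (2 * j * h - j * l * Q) = (i * j) * (2 * h - l * Q)" for i j l
      by (simp add: algebra_simps)
    ultimately show ?thesis by (metis mult_1)
  qed
  finally have E1: "\<psi> / (\<psi> - 1) * quad S (u (Suc (Suc (Suc k))) - xs) - \<psi> / (\<psi> - 1) * quad S (u (Suc (Suc k)) - xs)
      = 2 * h - (1 + 1 / \<psi>) * quad S (v + c)" unfolding u2 u3 Q_def Q'_def .
  have "(norm (y k - ys))\<^sup>2 = (norm ((y (Suc k) - ys) - dy k))\<^sup>2" by simp
  also have "\<dots> = (norm (y (Suc k) - ys))\<^sup>2 + 2 * ((ys - y (Suc k)) \<bullet> dy k) + (norm (dy k))\<^sup>2"
    unfolding power2_norm_eq_inner by (simp add: inner_diff_left inner_diff_right inner_commute)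
  finally have E2: "1 / \<beta> * (norm (y k - ys))\<^sup>2
      = 1 / \<beta> * (norm (y (Suc k) - ys))\<^sup>2 + 2 / \<beta> * ((ys - y (Suc k)) \<bullet> dy k) + 1 / \<beta> * (norm (dy k))\<^sup>2"
    by (simp add: distrib_left)
  have "quad T (w k - ws) = quad T (e - dw k)" by (simp add: e_def)
  also have "\<dots> = quad T e - 2 * (dw k \<bullet> (T *v e)) + quad T (dw k)"
    unfolding quad_diff[OF T] sym_pos_def_commute[OF T, of e "dw k"] by simp
  finally have eq: "quad T (w k - ws) = quad T e - 2 * (dw k \<bullet> (T *v e)) + quad T (dw k)" .
  have "p * quad T (w k - ws) = p * quad T e - 2 * p * (dw k \<bullet> (T *v e)) + p * quad T (dw k)"
    unfolding eq by (simp only: distrib_left right_diff_distrib ac_simps)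
  \<comment> \<open>The inequality carries the new step size, the energy at \<open>k\<close> the old
    one; monotonicity of \<open>\<tau>\<close> bridges the two.\<close>
  moreover have "p * quad T (w k - ws) \<le> \<tau> k * quad T (w k - ws)"
    unfolding p_def using \<tau>_Suc_le quad_nonneg[OF T] by (rule mult_right_mono)
  ultimately show ?thesis
    using main E1 E2 unfolding energy_def v_def[symmetric] c_def[symmetric] p_def[symmetric]
      e_def[symmetric] h_def[symmetric]
    by linarith
qed

text \<open>Both step-size ratios tend to \<open>1\<close> because \<open>\<tau>\<close> has a
  positive limit, so \<open>quad_form_lower_bound\<close> applies from some index on. That index
  depends only on the step sizes and is common to all saddle points.\<close>

lemma energy_decrease:
  obtains \<epsilon> where "\<epsilon> > 0"
    "eventually (\<lambda>k. \<forall>xs ws ys. saddle_point g f A B b (xs, ws, ys) \<longrightarrow>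
       energy xs ws ys (Suc k) + (\<epsilon> * (quad S (dx k) + quad S (gap k) + (norm (dy k))\<^sup>2 / \<beta>)
         + \<tau> (Suc k) * quad T (dw k)) \<le> energy xs ws ys k) sequentially"
proof -
  define D where "D = 1 + 1 / \<psi>"
  have D: "D > 1" unfolding D_def using \<psi> by simp
  obtain \<epsilon> where \<epsilon>: "0 < \<epsilon>" "2 * \<epsilon> < 1"
    "2 * \<epsilon> \<le> D - (\<psi> - D)\<^sup>2 / (D - 2 * \<epsilon>) - \<mu>\<^sup>2 / (1 - 2 * \<epsilon>)"
    using coefficient_margin[OF \<psi> \<mu>] unfolding D_def by blast
  obtain t where t: "t > 0" "\<tau> \<longlonglongrightarrow> t" using \<tau>_lim by blast
  have t': "(\<lambda>k. \<tau> (Suc k)) \<longlonglongrightarrow> t" "(\<lambda>k. \<tau> (Suc (Suc k))) \<longlonglongrightarrow> t"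
    using t(2) LIMSEQ_Suc by blast+
  have "(\<lambda>k. (1 - \<tau> (Suc k) / \<tau> k) * \<psi> + (\<tau> (Suc k) / \<tau> (Suc (Suc k)) - 1) * \<mu>)
      \<longlonglongrightarrow> (1 - t / t) * \<psi> + (t / t - 1) * \<mu>"
    using t by (intro tendsto_intros t') auto
  then have "eventually (\<lambda>k. (1 - \<tau> (Suc k) / \<tau> k) * \<psi> + (\<tau> (Suc k) / \<tau> (Suc (Suc k)) - 1) * \<mu> < \<epsilon>) sequentially"
    using t(1) \<epsilon>(1) by (intro order_tendstoD(2)) auto
  then have "eventually (\<lambda>k. \<forall>xs ws ys. saddle_point g f A B b (xs, ws, ys) \<longrightarrow>
       energy xs ws ys (Suc k) + (\<epsilon> * (quad S (dx k) + quad S (gap k) + (norm (dy k))\<^sup>2 / \<beta>)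
         + \<tau> (Suc k) * quad T (dw k)) \<le> energy xs ws ys k) sequentially"
  proof eventually_elim
    case (elim k)
    \<comment> \<open>The coupling term carries \<open>\<tau> (Suc k)\<close>, but
      \<open>\<tau>_norm_A\<close> controls \<open>A *v dx k\<close> with the next step size;
      \<open>\<rho>\<close> is the price. The scaling of \<open>z\<close> removes
      \<open>\<beta>\<close> from the quadratic form.\<close>
    define \<rho> where "\<rho> = \<tau> (Suc k) / \<tau> (Suc (Suc k))"
    define z where "z = norm (dy k) / sqrt \<beta>"
    define p where "p = sqrt (quad S (dx k))"
    have z2: "z\<^sup>2 = (norm (dy k))\<^sup>2 / \<beta>" unfolding z_def using \<beta> by (simp add: power_divide)
    have \<rho>: "\<rho> \<ge> 1" "\<tau> (Suc k) = \<rho> * \<tau> (Suc (Suc k))"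
      unfolding \<rho>_def using \<tau>_Suc_le[of "Suc k"] \<tau>_pos[of "Suc (Suc k)"] by simp_all
    have "\<bar>dy k \<bullet> (A *v dx k)\<bar> \<le> norm (dy k) * norm (A *v dx k)" by (rule Cauchy_Schwarz_ineq2)
    then have "\<tau> (Suc k) * \<bar>dy k \<bullet> (A *v dx k)\<bar> \<le> \<tau> (Suc k) * (norm (dy k) * norm (A *v dx k))"
      using \<tau>_pos[of "Suc k"] by (intro mult_left_mono) auto
    also have "\<dots> = \<rho> * norm (dy k) * (\<tau> (Suc (Suc k)) * norm (A *v dx k))"
      unfolding \<rho>(2) by simp
    also have "\<dots> \<le> \<rho> * norm (dy k) * (\<mu> / sqrt \<beta> * p)"
      unfolding p_def using \<rho>(1) by (intro mult_left_mono \<tau>_norm_A) auto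
    also have "\<dots> = \<rho> * \<mu> * z * p" unfolding z_def by simp
    finally have "\<bar>\<tau> (Suc k) * (dy k \<bullet> (A *v dx k))\<bar> \<le> \<rho> * \<mu> * z * p"
      using \<tau>_pos[of "Suc k"] by (simp add: abs_mult)
    then have "- (2 * (\<rho> * \<mu> * z * p)) \<le> 2 * (\<tau> (Suc k) * (dy k \<bullet> (A *v dx k)))" by linarith
    then have X: "2 * \<tau> (Suc k) * (dy k \<bullet> (A *v dx k)) \<ge> - (2 * \<rho> * \<mu> * z * sqrt (quad S (dx k)))"
      unfolding p_def by (simp only: mult.assoc)
    have "\<tau> (Suc k) / \<tau> k \<le> 1" using \<tau>_Suc_le[of k] \<tau>_pos[of k] by simp
    then have low: "\<epsilon> * (quad S (dx k) + quad S (gap k) + z\<^sup>2)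
      \<le> D * quad S (dx k + gap k) - 2 * (\<tau> (Suc k) / \<tau> k) * \<psi> * (dx k \<bullet> (S *v gap k)) + z\<^sup>2
        + 2 * \<tau> (Suc k) * (dy k \<bullet> (A *v dx k))"
      using \<psi> \<mu> \<rho> elim unfolding \<rho>_def[symmetric]
      by (intro quad_form_lower_bound[OF S D \<epsilon> _ _ _ _ _ X]) auto
    show ?case
    proof (intro allI impI)
      fix xs ws ys assume "saddle_point g f A B b (xs, ws, ys)"
      from energy_step[OF this, of k]
      show "energy xs ws ys (Suc k) + (\<epsilon> * (quad S (dx k) + quad S (gap k) + (norm (dy k))\<^sup>2 / \<beta>)
         + \<tau> (Suc k) * quad T (dw k)) \<le> energy xs ws ys k"
        using low unfolding D_def z2 by simp
    qed
  qed
  then show thesis using that \<epsilon>(1) by blast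
qed

lemma
  assumes saddle: "saddle_point g f A B b (xs, ws, ys)"
  shows energy_convergent: "convergent (energy xs ws ys)"
    and dx_tendsto_0: "(\<lambda>k. dx k) \<longlonglongrightarrow> 0"
    and gap_tendsto_0: "(\<lambda>k. gap k) \<longlonglongrightarrow> 0"
    and dy_tendsto_0: "(\<lambda>k. dy k) \<longlonglongrightarrow> 0"
    and dw_tendsto_0: "(\<lambda>k. dw k) \<longlonglongrightarrow> 0"
proof -
  obtain \<epsilon> where \<epsilon>: "\<epsilon> > 0" and
    ev: "eventually (\<lambda>k. \<forall>xs ws ys. saddle_point g f A B b (xs, ws, ys) \<longrightarrow>
       energy xs ws ys (Suc k) + (\<epsilon> * (quad S (dx k) + quad S (gap k) + (norm (dy k))\<^sup>2 / \<beta>)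
         + \<tau> (Suc k) * quad T (dw k)) \<le> energy xs ws ys k) sequentially"
    using energy_decrease by blast
  obtain t where t: "t > 0" "\<And>k. t \<le> \<tau> k" using \<tau>_bounded_below by blast
  define R where "R k = \<epsilon> * (quad S (dx k) + quad S (gap k) + (norm (dy k))\<^sup>2 / \<beta>)
         + \<tau> (Suc k) * quad T (dw k)" for k
  have nn: "0 \<le> quad S (dx k)" "0 \<le> quad S (gap k)" "0 \<le> quad T (dw k)" "0 \<le> (norm (dy k))\<^sup>2 / \<beta>"
    "0 \<le> \<tau> (Suc k) * quad T (dw k)" for k
    using quad_nonneg[OF S] quad_nonneg[OF T] \<beta> \<tau>_pos[of "Suc k"] by simp_all
  have "\<forall>\<^sub>F k in sequentially. energy xs ws ys (Suc k) + R k \<le> energy xs ws ys k"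
    using ev unfolding R_def by eventually_elim (use saddle in blast)
  moreover have "0 \<le> R k" for k unfolding R_def using \<epsilon> nn[of k] by simp
  ultimately have E: "convergent (energy xs ws ys)" and R: "R \<longlonglongrightarrow> 0"
    using decreasing_energy[of "energy xs ws ys" R] energy_nonneg by blast+
  show "convergent (energy xs ws ys)" by (rule E)
  have null: "h \<longlonglongrightarrow> 0" if "\<And>k. 0 \<le> h k" "\<And>k. C * h k \<le> R k" "C > 0" for h :: "nat \<Rightarrow> real" and C
  proof (rule tendsto_sandwich[where f = "\<lambda>_. 0"])
    show "(\<lambda>k. R k / C) \<longlonglongrightarrow> 0" using tendsto_divide[OF R tendsto_const[of C]] that(3) by simp
    show "\<forall>\<^sub>F k in sequentially. h k \<le> R k / C"
      using that by (intro always_eventually allI) (simp add: field_simps)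
  qed (use that in auto)
  have le: "\<epsilon> * quad S (dx k) \<le> R k" "\<epsilon> * quad S (gap k) \<le> R k"
    "\<epsilon> * ((norm (dy k))\<^sup>2 / \<beta>) \<le> R k" "\<tau> (Suc k) * quad T (dw k) \<le> R k" for k
    using mult_nonneg_nonneg[OF less_imp_le[OF \<epsilon>] nn(1)[of k]] nn(5)[of k]
      mult_nonneg_nonneg[OF less_imp_le[OF \<epsilon>] nn(2)[of k]]
      mult_nonneg_nonneg[OF less_imp_le[OF \<epsilon>] nn(4)[of k]]
    unfolding R_def distrib_left by linarith+
  have "(\<lambda>k. quad S (dx k)) \<longlonglongrightarrow> 0" "(\<lambda>k. quad S (gap k)) \<longlonglongrightarrow> 0" "(\<lambda>k. (norm (dy k))\<^sup>2 / \<beta>) \<longlonglongrightarrow> 0"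
    by (rule null[OF nn(1) le(1) \<epsilon>], rule null[OF nn(2) le(2) \<epsilon>], rule null[OF nn(4) le(3) \<epsilon>])
  note lim = this
  have "(\<lambda>k. quad T (dw k)) \<longlonglongrightarrow> 0"
  \<comment> \<open>The weight \<open>\<tau> (Suc k)\<close> varies with \<open>k\<close>; its
    uniform lower bound \<open>t\<close> serves as the constant.\<close>
  proof (rule null[where C = t])
    show "t * quad T (dw k) \<le> R k" for k
      using mult_right_mono[OF t(2)[of "Suc k"] nn(3)[of k]] le(4)[of k] by linarith
  qed (use nn t in auto)
  then show "(\<lambda>k. dw k) \<longlonglongrightarrow> 0" by (rule tendsto_0_if_quad_tendsto_0[OF T])
  show "(\<lambda>k. dx k) \<longlonglongrightarrow> 0" "(\<lambda>k. gap k) \<longlonglongrightarrow> 0"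
    using lim(1,2) by (blast intro: tendsto_0_if_quad_tendsto_0[OF S])+
  have "(\<lambda>k. sqrt (\<beta> * ((norm (dy k))\<^sup>2 / \<beta>))) \<longlonglongrightarrow> sqrt (\<beta> * 0)"
    by (intro tendsto_intros lim(3))
  then show "(\<lambda>k. dy k) \<longlonglongrightarrow> 0" using \<beta> by (simp add: tendsto_norm_zero_iff)
qed

section \<open>Cluster points and convergence of the whole sequence\<close>

abbreviation (input) "state k \<equiv> (u (Suc (Suc k)), w k, y k)"

text \<open>The uniform lower bound on \<open>\<tau>\<close> keeps the weight of the
  \<open>w\<close> part away from \<open>0\<close>, so one \<open>\<alpha>\<close> works for every
  index and every reference point.\<close>

lemma energy_coercive:
  obtains \<alpha> where "\<alpha> > 0" "\<And>xs ws ys k. \<alpha> * (norm (state k - (xs, ws, ys)))\<^sup>2 \<le> energy xs ws ys k"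
proof -
  obtain t where t: "t > 0" "\<And>k. t \<le> \<tau> k" using \<tau>_bounded_below by blast
  define \<alpha> where "\<alpha> = min (\<psi> / (\<psi> - 1) * lambda_min S) (min (1 / \<beta>) (t * lambda_min T))"
  have "\<alpha> > 0" unfolding \<alpha>_def using \<psi> \<beta> t lambda_min_pos[OF S] lambda_min_pos[OF T] by simp
  moreover have "\<alpha> * (norm (state k - (xs, ws, ys)))\<^sup>2 \<le> energy xs ws ys k" for xs ws ys k
  proof -
    have "\<alpha> * (norm (u (Suc (Suc k)) - xs))\<^sup>2 \<le> \<psi> / (\<psi> - 1) * lambda_min S * (norm (u (Suc (Suc k)) - xs))\<^sup>2"
      unfolding \<alpha>_def by (intro mult_right_mono) auto
    also have "\<dots> \<le> \<psi> / (\<psi> - 1) * quad S (u (Suc (Suc k)) - xs)"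
      unfolding mult.assoc using \<psi> by (intro mult_left_mono lambda_min_le_quad[OF S]) auto
    finally have 1: "\<alpha> * (norm (u (Suc (Suc k)) - xs))\<^sup>2 \<le> \<psi> / (\<psi> - 1) * quad S (u (Suc (Suc k)) - xs)" .
    have 2: "\<alpha> * (norm (y k - ys))\<^sup>2 \<le> 1 / \<beta> * (norm (y k - ys))\<^sup>2"
      unfolding \<alpha>_def by (intro mult_right_mono) auto
    have "\<alpha> * (norm (w k - ws))\<^sup>2 \<le> t * lambda_min T * (norm (w k - ws))\<^sup>2"
      unfolding \<alpha>_def by (intro mult_right_mono) auto
    also have "\<dots> \<le> \<tau> k * quad T (w k - ws)"
      unfolding mult.assoc using t \<tau>_pos[of k] lambda_min_pos[OF T]
      by (intro mult_mono lambda_min_le_quad[OF T]) auto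
    finally have 3: "\<alpha> * (norm (w k - ws))\<^sup>2 \<le> \<tau> k * quad T (w k - ws)" .
    have "(norm (state k - (xs, ws, ys)))\<^sup>2
        = (norm (u (Suc (Suc k)) - xs))\<^sup>2 + ((norm (w k - ws))\<^sup>2 + (norm (y k - ys))\<^sup>2)"
      by (simp add: norm_Pair)
    then show ?thesis using 1 2 3 unfolding energy_def by (simp add: distrib_left)
  qed
  ultimately show thesis using that by blast
qed

text \<open>Pass to the limit in both variational inequalities and in the multiplier update; the
  proximal terms disappear with the increments, leaving the hypotheses of
  \<open>saddle_pointI\<close>.\<close>

lemma cluster_point_saddle:
  assumes saddle: "saddle_point g f A B b (xbar, wbar, ybar)"
    and r: "strict_mono r" and lim: "(\<lambda>k. state (r k)) \<longlonglongrightarrow> (xs, ws, ys)"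
  shows "saddle_point g f A B b (xs, ws, ys)"
proof -
  have sub: "(\<lambda>k. h (r k)) \<longlonglongrightarrow> l" if "h \<longlonglongrightarrow> l" for h :: "nat \<Rightarrow> 'c::topological_space" and l
    using LIMSEQ_subseq_LIMSEQ[OF that r] by (simp add: o_def)
  have lu: "(\<lambda>k. u (Suc (Suc (r k)))) \<longlonglongrightarrow> xs" and lw: "(\<lambda>k. w (r k)) \<longlonglongrightarrow> ws" and ly: "(\<lambda>k. y (r k)) \<longlonglongrightarrow> ys"
    using tendsto_fst[OF lim] tendsto_fst[OF tendsto_snd[OF lim]] tendsto_snd[OF tendsto_snd[OF lim]] by simp_all
  note dx0 = sub[OF dx_tendsto_0[OF saddle]] and gap0 = sub[OF gap_tendsto_0[OF saddle]]
    and dy0 = sub[OF dy_tendsto_0[OF saddle]] and dw0 = sub[OF dw_tendsto_0[OF saddle]]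
  \<comment> \<open>\<open>state\<close> contains only \<open>u\<close>, \<open>w\<close> and
    \<open>y\<close>; the vanishing gap and increments carry its limit over to \<open>x\<close> and
    to the shifted indices.\<close>
  have lx1: "(\<lambda>k. x (Suc (r k))) \<longlonglongrightarrow> xs" using tendsto_add[OF gap0 lu] by simp
  have lx2: "(\<lambda>k. x (Suc (Suc (r k)))) \<longlonglongrightarrow> xs" using tendsto_add[OF dx0 lx1] by simp
  have lw1: "(\<lambda>k. w (Suc (r k))) \<longlonglongrightarrow> ws" using tendsto_add[OF dw0 lw] by simp
  have ly1: "(\<lambda>k. y (Suc (r k))) \<longlonglongrightarrow> ys" using tendsto_add[OF dy0 ly] by simp
  have lxu: "(\<lambda>k. x (Suc (Suc (r k))) - u (Suc (Suc (r k)))) \<longlonglongrightarrow> 0" using tendsto_diff[OF lx2 lu] by simp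
  obtain t where t: "t > 0" "\<tau> \<longlonglongrightarrow> t" using \<tau>_lim by blast
  have lt: "(\<lambda>k. \<tau> (Suc (r k))) \<longlonglongrightarrow> t" using sub[OF LIMSEQ_Suc[OF t(2)]] .
  have mult: "((\<lambda>k. M *v h k) \<longlongrightarrow> M *v l) F" if "(h \<longlongrightarrow> l) F" for M :: "real^'i^'j" and h :: "nat \<Rightarrow> real^'i" and l F
    using bounded_linear.tendsto[OF matrix_vector_mul_bounded_linear that] .
  show ?thesis
  proof (rule saddle_pointI[OF g(1) f(1)])
    \<comment> \<open>The residual is a rescaled multiplier increment, and the scaling stays bounded
      because \<open>\<tau>\<close> has a positive limit.\<close>
    have "A *v x (Suc k) + B *v w (Suc k) - b = (1 / (\<beta> * \<tau> (Suc k))) *\<^sub>R dy k" for k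
      unfolding y_Suc using \<beta> \<tau>_pos[of "Suc k"] by simp
    then have "(\<lambda>k. A *v x (Suc (r k)) + B *v w (Suc (r k)) - b) \<longlonglongrightarrow> (1 / (\<beta> * t)) *\<^sub>R 0"
      using t(1) \<beta> by (simp only:) (intro tendsto_intros lt dy0, auto)
    moreover have "(\<lambda>k. A *v x (Suc (r k)) + B *v w (Suc (r k)) - b) \<longlonglongrightarrow> A *v xs + B *v ws - b"
      by (intro tendsto_intros mult lx1 lw1)
    ultimately have "A *v xs + B *v ws - b = (1 / (\<beta> * t)) *\<^sub>R 0" by (rule LIMSEQ_unique[rotated])
    then show "A *v xs + B *v ws = b" by simp
  next
    fix z
    show "g xs \<le> g z + ereal (ys \<bullet> (A *v (z - xs)))"
    proof (cases "g z")
      case (real \<zeta>)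
      \<comment> \<open>For finite \<open>g z\<close> the upper bounds are real numbers, as
        \<open>closed_funD\<close> requires; the proximal part tends to \<open>0\<close> with
        \<open>x - u\<close>.\<close>
      have "(\<lambda>k. \<zeta> + (y (Suc (r k)) \<bullet> (A *v (z - x (Suc (Suc (r k)))))
        + 1 / \<tau> (Suc (r k)) * ((x (Suc (Suc (r k))) - u (Suc (Suc (r k)))) \<bullet> (S *v (z - x (Suc (Suc (r k))))))))
        \<longlonglongrightarrow> \<zeta> + (ys \<bullet> (A *v (z - xs)) + 1 / t * (0 \<bullet> (S *v (z - xs))))"
        using t(1) by (intro tendsto_intros mult lxu lx2 ly1 lt) auto
      then have "g xs \<le> ereal (\<zeta> + (ys \<bullet> (A *v (z - xs)) + 1 / t * (0 \<bullet> (S *v (z - xs)))))"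
        using x_variational[of "Suc (r _)" z] unfolding real
        by (intro closed_funD[OF g(2) lx2]) simp_all
      then show ?thesis unfolding real by simp
    qed (use g(1) in \<open>auto simp: proper_fun_def\<close>)
    fix v
    show "f ws \<le> f v + ereal (ys \<bullet> (B *v (v - ws)))"
    proof (cases "f v")
      case (real \<zeta>)
      have "(\<lambda>k. \<zeta> + (y (Suc (r k)) \<bullet> (B *v (v - w (Suc (r k))))
        + (w (Suc (r k)) - w (r k)) \<bullet> (T *v (v - w (Suc (r k))))))
        \<longlonglongrightarrow> \<zeta> + (ys \<bullet> (B *v (v - ws)) + 0 \<bullet> (T *v (v - ws)))"
        by (intro tendsto_intros mult lw1 ly1 dw0)
      then have "f ws \<le> ereal (\<zeta> + (ys \<bullet> (B *v (v - ws)) + 0 \<bullet> (T *v (v - ws))))"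
        using w_variational[of "r _" v] unfolding real
        by (intro closed_funD[OF f(2) lw1]) simp_all
      then show ?thesis unfolding real by simp
    qed (use f(1) in \<open>auto simp: proper_fun_def\<close>)
  qed
qed

text \<open>An Opial-type argument: bounded energy gives a cluster point, which is a saddle point
  and so may replace the given one as centre of the energy.\<close>

lemma convergence_to_saddle:
  assumes saddle: "saddle_point g f A B b (xbar, wbar, ybar)"
  shows "\<exists>xs ws ys. saddle_point g f A B b (xs, ws, ys) \<and> (\<lambda>k. (x k, w k, y k)) \<longlonglongrightarrow> (xs, ws, ys)"
proof -
  obtain \<alpha> where \<alpha>: "\<alpha> > 0" "\<And>xs ws ys k. \<alpha> * (norm (state k - (xs, ws, ys)))\<^sup>2 \<le> energy xs ws ys k"
    using energy_coercive by blast
  have norm_le: "norm (state k - (xs, ws, ys)) \<le> sqrt (energy xs ws ys k / \<alpha>)" for xs ws ys k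
    using \<alpha> by (intro real_le_rsqrt) (simp add: field_simps)
  have "Bseq (energy xbar wbar ybar)"
    using energy_convergent[OF saddle] by (rule convergent_imp_Bseq)
  then obtain C where C: "\<And>k. energy xbar wbar ybar k \<le> C"
    unfolding Bseq_def by (metis abs_le_D1 real_norm_def)
  have "norm (state k) \<le> norm (xbar, wbar, ybar) + sqrt (C / \<alpha>)" for k
  proof -
    have "norm (state k - (xbar, wbar, ybar)) \<le> sqrt (energy xbar wbar ybar k / \<alpha>)" by (rule norm_le)
    also have "\<dots> \<le> sqrt (C / \<alpha>)" using C \<alpha>(1) by (simp add: divide_right_mono)
    finally show ?thesis using norm_triangle_sub[of "state k" "(xbar, wbar, ybar)"] by linarith
  qed
  then have "bounded (range (\<lambda>k. state k))" unfolding bounded_iff by blast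
  then obtain l r where r: "strict_mono r" and "((\<lambda>k. state k) \<circ> r) \<longlonglongrightarrow> l"
    using bounded_imp_convergent_subsequence by blast
  moreover obtain xs ws ys where "l = (xs, ws, ys)" by (cases l)
  ultimately have lim: "(\<lambda>k. state (r k)) \<longlonglongrightarrow> (xs, ws, ys)" by (simp add: o_def)
  have saddle': "saddle_point g f A B b (xs, ws, ys)"
    by (rule cluster_point_saddle[OF saddle r lim])
  \<comment> \<open>The recentred energy converges along the full sequence, so its limit can be read
    off the subsequence, where it is \<open>0\<close>.\<close>
  obtain e where e: "energy xs ws ys \<longlonglongrightarrow> e" using energy_convergent[OF saddle'] convergent_def by blast
  obtain t where t: "\<tau> \<longlonglongrightarrow> t" using \<tau>_lim by blast
  have lu: "(\<lambda>k. u (Suc (Suc (r k)))) \<longlonglongrightarrow> xs" and lw: "(\<lambda>k. w (r k)) \<longlonglongrightarrow> ws" and ly: "(\<lambda>k. y (r k)) \<longlonglongrightarrow> ys"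
    using tendsto_fst[OF lim] tendsto_fst[OF tendsto_snd[OF lim]] tendsto_snd[OF tendsto_snd[OF lim]] by simp_all
  have lt: "(\<lambda>k. \<tau> (r k)) \<longlonglongrightarrow> t" using LIMSEQ_subseq_LIMSEQ[OF t r] by (simp add: o_def)
  have "(\<lambda>k. energy xs ws ys (r k)) \<longlonglongrightarrow> \<psi> / (\<psi> - 1) * quad S (xs - xs)
     + 1 / \<beta> * (norm (ys - ys))\<^sup>2 + t * quad T (ws - ws)"
    unfolding energy_def by (intro tendsto_add tendsto_mult tendsto_const tendsto_power tendsto_norm
        tendsto_diff quad_tendsto lu lw ly lt)
  moreover have "(\<lambda>k. energy xs ws ys (r k)) \<longlonglongrightarrow> e" using LIMSEQ_subseq_LIMSEQ[OF e r] by (simp add: o_def)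
  ultimately have "e = 0" using LIMSEQ_unique by fastforce
  then have "(\<lambda>k. sqrt (energy xs ws ys k / \<alpha>)) \<longlonglongrightarrow> sqrt (0 / \<alpha>)"
    using e \<alpha>(1) by (intro tendsto_intros) auto
  then have "(\<lambda>k. state k - (xs, ws, ys)) \<longlonglongrightarrow> 0"
    using norm_le by (intro Lim_null_comparison[of "\<lambda>k. state k - (xs, ws, ys)"] always_eventually) auto
  then have lim: "(\<lambda>k. state k) \<longlonglongrightarrow> (xs, ws, ys)" by (rule LIM_zero_cancel)
  then have lu: "(\<lambda>k. u (Suc (Suc k))) \<longlonglongrightarrow> xs" and lw: "w \<longlonglongrightarrow> ws" and ly: "y \<longlonglongrightarrow> ys"
    using tendsto_fst[OF lim] tendsto_fst[OF tendsto_snd[OF lim]] tendsto_snd[OF tendsto_snd[OF lim]] by simp_all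
  \<comment> \<open>The energy controls \<open>u\<close> but not \<open>x\<close>; the vanishing gap
    recovers the limit of \<open>x\<close>.\<close>
  have "(\<lambda>k. x (Suc k)) \<longlonglongrightarrow> xs" using tendsto_add[OF gap_tendsto_0[OF saddle] lu] by simp
  then have "x \<longlonglongrightarrow> xs" by (rule LIMSEQ_imp_Suc)
  then have "(\<lambda>k. (x k, w k, y k)) \<longlonglongrightarrow> (xs, ws, ys)" by (intro tendsto_Pair lw ly)
  then show ?thesis using saddle' by blast
qed

end

theorem theorem4p4:
  fixes g :: "real^'q \<Rightarrow> ereal" and f :: "real^'p \<Rightarrow> ereal"
    and A :: "real^'q^'m" and B :: "real^'p^'m" and b :: "real^'m"
    and S :: "real^'q^'q" and T :: "real^'p^'p"
    and \<psi> \<beta> \<mu> :: real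
    and u x :: "nat \<Rightarrow> real^'q" and w :: "nat \<Rightarrow> real^'p" and y :: "nat \<Rightarrow> real^'m"
    and \<tau> :: "nat \<Rightarrow> real"
    and xbar :: "real^'q" and wbar :: "real^'p" and ybar :: "real^'m"
  assumes "proper_fun g" "closed_fun g" "convex_fun g"
    and "proper_fun f" "closed_fun f" "convex_fun f"
    and "standing_assumption g f A B b"
    and "saddle_point g f A B b (xbar, wbar, ybar)"
    and "sym_pos_def S" "sym_pos_def T"
    and "\<tau> 0 > 0" "\<beta> > 0"
    and "1 < \<psi>" "\<psi> < 1 + sqrt 3"
    and "0 < \<mu>" "\<mu> < \<psi> * (2 + 2 * \<psi> - \<psi>\<^sup>2) / (2 * (\<psi> + 1))"
    and "generated_by_algorithm g f A B b S T \<psi> \<beta> \<mu> u x w y \<tau>"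
  shows "\<exists>xs ws ys. saddle_point g f A B b (xs, ws, ys) \<and>
           (\<lambda>k. (x k, w k, y k)) \<longlonglongrightarrow> (xs, ws, ys)"
proof -
  interpret algorithm_run g f A B b S T \<psi> \<beta> \<mu> u x w y \<tau>
    by unfold_locales (use assms in simp_all)
  show ?thesis using assms(8) by (rule convergence_to_saddle)
qed

end
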